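(* Let $(X_{i,j})_{(i,j)\in\mathbb{N}^2}$ be an infinite array of independent identically distributed random variables on one probability space, and let $\gamma\geq 1$ be fixed. Assume that one of the following two cases holds, with the associated constants $a,b$. (E) Exponential case: the $X_{i,j}$ are exponential with parameter $1$, and $a=(1+\sqrt{\gamma})^2$, $b=\gamma^{-1/6}(1+\sqrt{\gamma})^{4/3}$. (G) Geometric case: for some $q\in(0,1)$, $\mathbb{P}(X_{i,j}=k)=(1-q)q^k$ for $k=0,1,2,\dots$, and $$a=\frac{(1+\sqrt{q\gamma})^2}{1-q}-1,\qquad b=\frac{q^{1/6}\gamma^{-1/6}}{1-q}\,(\sqrt{\gamma}+\sqrt{q})^{2/3}(1+\sqrt{q\gamma})^{2/3}.$$ For integers $M,N\geq 1$ let $\Pi_{M,N}$ be the set of all up/right paths in $\mathbb{N}^2$ joining $(1,1)$ to $(M,N)$, let $H(M,N)=\max\{\sum_{(i,j)\in\pi}X_{i,j}\,;\ \pi\in\Pi_{M,N}\}$, and set $$\widetilde H_N=\frac{H([\gamma N],N)-aN}{bN^{1/3}},\qquad N\geq 1.$$ Assume that the following tail bound holds: there are constants $x_0>1$, $\delta>0$, $C>0$ and $N_0\geq 1$ such that for all $N\geq N_0$ and all $x$ with $x_0\leq x\leq\delta N^{1/3}$, $$\Big|\log\mathbb{P}\big(H([\gamma N],N)\geq aN+xbN^{1/3}\big)+\frac43\,x^{3/2}\Big|\ \leq\ C\big(x^2N^{-1/3}+\log x\big).$$ Then, with probability one, $$\limsup_{N\to\infty}\frac{\widetilde H_N}{(\log\log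 N)^{2/3}}=\Big(\frac34\Big)^{2/3}.$$
   Context: Here $\mathbb{N}=\{1,2,3,\dots\}$ and $[x]$ denotes the integer part of $x$. An up/right path from $(i_0,j_0)$ to $(i_1,j_1)$ is a finite sequence of points of $\mathbb{N}^2$ starting at $(i_0,j_0)$ and ending at $(i_1,j_1)$, each step of which adds $(1,0)$ or $(0,1)$. All the variables $\widetilde H_N$, $N\geq 1$, are built from the same array $(X_{i,j})$. *)

theory Defs
  imports "HOL-Probability.Probability"
begin

definition lattice :: "(nat \<times> nat) set" where
  "lattice = {1..} \<times> {1..}"

definition up_right_step :: "nat \<times> nat \<Rightarrow> nat \<times> nat \<Rightarrow> bool" where
  "up_right_step p p' \<longleftrightarrow>
     p' = (fst p + 1, snd p) \<or> p' = (fst p, snd p + 1)"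

definition up_right_path :: "nat \<times> nat \<Rightarrow> nat \<times> nat \<Rightarrow> (nat \<times> nat) list \<Rightarrow> bool" where
  "up_right_path p0 p1 \<pi> \<longleftrightarrow>
     \<pi> \<noteq> [] \<and> set \<pi> \<subseteq> lattice \<and> hd \<pi> = p0 \<and> last \<pi> = p1 \<and>
     (\<forall>k. Suc k < length \<pi> \<longrightarrow> up_right_step (\<pi> ! k) (\<pi> ! Suc k))"

definition paths :: "nat \<Rightarrow> nat \<Rightarrow> (nat \<times> nat) list set" where
  "paths m n = {\<pi>. up_right_path (1, 1) (m, n) \<pi>}"

text \<open>For \<open>m, n \<ge> 1\<close> the set of paths is finite and nonempty, so \<open>Max\<close> below is a
  genuine maximum. An up/right path never visits a point twice, so summing over the
  set of its points agrees with summing along the list.\<close>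

definition last_passage :: "(nat \<times> nat \<Rightarrow> 'w \<Rightarrow> real) \<Rightarrow> nat \<Rightarrow> nat \<Rightarrow> 'w \<Rightarrow> real" where
  "last_passage X m n \<omega> = Max ((\<lambda>\<pi>. \<Sum>p\<in>set \<pi>. X p \<omega>) ` paths m n)"

definition rescaled_passage ::
  "(nat \<times> nat \<Rightarrow> 'w \<Rightarrow> real) \<Rightarrow> real \<Rightarrow> real \<Rightarrow> real \<Rightarrow> nat \<Rightarrow> 'w \<Rightarrow> real" where
  "rescaled_passage X \<gamma> a b N \<omega> =
     (last_passage X (nat \<lfloor>\<gamma> * real N\<rfloor>) N \<omega> - a * real N) / (b * real N powr (1/3))"

definition exponential_case ::
  "'w measure \<Rightarrow> (nat \<times> nat \<Rightarrow> 'w \<Rightarrow> real) \<Rightarrow> real \<Rightarrow> real \<Rightarrow> real \<Rightarrow> bool" where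
  "exponential_case M X \<gamma> a b \<longleftrightarrow>
     (\<forall>p\<in>lattice. distributed M lborel (X p) (exponential_density 1)) \<and>
     a = (1 + sqrt \<gamma>)\<^sup>2 \<and>
     b = \<gamma> powr (-1/6) * (1 + sqrt \<gamma>) powr (4/3)"

definition geometric_case ::
  "'w measure \<Rightarrow> (nat \<times> nat \<Rightarrow> 'w \<Rightarrow> real) \<Rightarrow> real \<Rightarrow> real \<Rightarrow> real \<Rightarrow> bool" where
  "geometric_case M X \<gamma> a b \<longleftrightarrow>
     (\<exists>q::real. 0 < q \<and> q < 1 \<and>
        (\<forall>p\<in>lattice. \<forall>k::nat. \<P>(\<omega> in M. X p \<omega> = real k) = (1 - q) * q ^ k) \<and>
        a = (1 + sqrt (q * \<gamma>))\<^sup>2 / (1 - q) - 1 \<and>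
        b = q powr (1/6) * \<gamma> powr (-1/6) / (1 - q)
              * (sqrt \<gamma> + sqrt q) powr (2/3) * (1 + sqrt (q * \<gamma>)) powr (2/3))"

text \<open>In HOL \<open>ln 0 = 0\<close>, whereas the bound on \<open>log P\<close> is meant to fail when \<open>P = 0\<close>;
  hence the explicit positivity clause.\<close>

definition tail_bound ::
  "'w measure \<Rightarrow> (nat \<times> nat \<Rightarrow> 'w \<Rightarrow> real) \<Rightarrow> real \<Rightarrow> real \<Rightarrow> real \<Rightarrow>
   real \<Rightarrow> real \<Rightarrow> real \<Rightarrow> nat \<Rightarrow> bool" where
  "tail_bound M X \<gamma> a b x0 \<delta> C N0 \<longleftrightarrow>
     (\<forall>N\<ge>N0. \<forall>x::real. x0 \<le> x \<and> x \<le> \<delta> * real N powr (1/3) \<longrightarrow>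
        (let P = \<P>(\<omega> in M. last_passage X (nat \<lfloor>\<gamma> * real N\<rfloor>) N \<omega>
                              \<ge> a * real N + x * b * real N powr (1/3))
         in 0 < P \<and>
            \<bar>ln P + 4/3 * x powr (3/2)\<bar> \<le> C * (x\<^sup>2 * real N powr (-1/3) + ln x)))"

end

theory Submission
  imports Defs "HOL-Real_Asymp.Real_Asymp"
begin

text \<open>The tail bound says that a rescaled passage time exceeds \<open>x\<close> with probability close to
  \<open>exp (- 4/3 * x powr (3/2))\<close>. At \<open>x = \<kappa> * (ln k) powr (2/3)\<close> this is roughly \<open>k\<close> to the power
  \<open>- 4/3 * \<kappa> powr (3/2)\<close>, which is summable or not according to whether \<open>\<kappa>\<close> lies above or below
  \<open>(3/4) powr (2/3)\<close>. So the theorem is a Borel-Cantelli argument along a sparse sequence \<open>N k\<close>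
  with \<open>ln (ln (N k))\<close> asymptotic to \<open>ln k\<close>, provided that the other indices can be
  controlled from this sequence and that the values along it can be compared with independent ones.

  Both are done by superadditivity. Write \<open>G s t\<close> for the passage time across the rows
  \<open>s + 1, ..., t\<close>, in a rectangle that begins diagonally after the one which ends in row \<open>s\<close>. Paths
  can be concatenated and the weights are nonnegative, so \<open>G 0 s + G s t \<le> G 0 t\<close>. Moreover \<open>G s t\<close>
  depends only on those rows and has the law of \<open>G 0 (t - s)\<close>.

  Comparing along the way requires that \<open>G s t\<close> is not far below \<open>a * (t - s)\<close>, and for this only an
  upper tail is given. The tail bound at the fixed value \<open>x0\<close> already yields a number \<open>p > 0\<close> with
  \<open>P (G 0 n \<ge> a * n) \<ge> p\<close> for all large \<open>n\<close> (\<open>central_probability\<close>). This weak lower bound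
  suffices because of a reflection principle (\<open>prob_UN_Int_ge\<close>): if \<open>B i\<close> is independent of
  \<open>A 0, ..., A i\<close> and has probability at least \<open>p\<close>, then the union of the events \<open>A i \<inter> B i\<close> has at
  least \<open>p\<close> times the probability of the union of the \<open>A i\<close>.

  For the upper bound, the principle is applied at the first index in a block \<open>\<rho>^k \<le> n < \<rho>^(k+1)\<close>
  where \<open>G 0 n\<close> is too large. With conditional probability at least \<open>p\<close> the excess persists until a
  time \<open>L\<close> just after the block, so the probability of an excess anywhere in the block is at most
  \<open>1 / p\<close> times that of an excess at \<open>L\<close> (\<open>maximal_inequality\<close>). With \<open>\<rho>\<close> close to 1, the
  first Borel-Cantelli lemma finishes the proof (\<open>AE_eventually_less\<close>).

  For the lower bound, \<open>N k = k ^ k\<close> and \<open>A k\<close> is the event that \<open>G (N k) (N (k+1))\<close> is large. These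
  events are independent and their probabilities have an infinite sum. The principle, applied at the
  last \<open>k\<close> in a range for which \<open>A k\<close> occurs, shows that with probability at least \<open>p\<close> some \<open>A k\<close>
  occurs together with \<open>G m (N k) \<ge> a * (N k - m)\<close>. Neglecting the first \<open>m\<close> rows costs only
  \<open>\<bar>a\<bar> * m\<close>, which is negligible, and makes the event independent of these rows. Letting \<open>m\<close> grow
  gives a tail event of probability at least \<open>p\<close>, hence of probability 1 by Kolmogorov's zero-one law
  (\<open>AE_frequently_ge\<close>).\<close>

section \<open>Up/right paths and last passage times\<close>

lemma up_right_path_iff:
  "up_right_path p0 p1 \<pi> \<longleftrightarrow>
     \<pi> \<noteq> [] \<and> set \<pi> \<subseteq> lattice \<and> hd \<pi> = p0 \<and> last \<pi> = p1 \<and> successively up_right_step \<pi>"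
  unfolding up_right_path_def successively_conv_nth by blast

text \<open>Both coordinates grow along a path, which is why a path stays in the rectangle spanned by
  its endpoints.\<close>
lemma up_right_path_mono:
  assumes "successively up_right_step \<pi>" "i \<le> j" "j < length \<pi>"
  shows "fst (\<pi> ! i) \<le> fst (\<pi> ! j) \<and> snd (\<pi> ! i) \<le> snd (\<pi> ! j)"
  using assms(2,3)
proof (induction j rule: dec_induct)
  case (step k)
  have "up_right_step (\<pi> ! k) (\<pi> ! Suc k)"
    using assms(1) step.prems by (simp add: successively_conv_nth)
  then show ?case using step by (auto simp: up_right_step_def)
qed auto

lemma path_points_subset_box:
  assumes "\<pi> \<in> paths m n"
  shows "set \<pi> \<subseteq> {1..m} \<times> {1..n}"
proof
  fix p assume "p \<in> set \<pi>"
  then obtain i where i: "i < length \<pi>" "p = \<pi> ! i" by (auto simp: in_set_conv_nth)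
  have "up_right_path (1,1) (m,n) \<pi>" using assms by (simp add: paths_def)
  then have s: "successively up_right_step \<pi>" "\<pi> \<noteq> []" "last \<pi> = (m,n)" "set \<pi> \<subseteq> lattice"
    by (auto simp: up_right_path_iff)
  have "fst p \<le> m \<and> snd p \<le> n"
    using up_right_path_mono[OF s(1), of i "length \<pi> - 1"] i s(2,3)
    by (auto simp: last_conv_nth)
  then show "p \<in> {1..m} \<times> {1..n}" using \<open>p \<in> set \<pi>\<close> s(4) by (auto simp: lattice_def)
qed

lemma paths_append_right:
  assumes "\<pi> \<in> paths m n"
  shows "\<pi> @ [(Suc m, n)] \<in> paths (Suc m) n"
proof -
  have \<pi>: "\<pi> \<noteq> []" "set \<pi> \<subseteq> lattice" "hd \<pi> = (1,1)" "last \<pi> = (m,n)" "successively up_right_step \<pi>"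
    using assms by (simp_all add: paths_def up_right_path_iff)
  have "(m,n) \<in> lattice" using \<pi> last_in_set[of \<pi>] by auto
  then have "(Suc m, n) \<in> lattice" by (simp add: lattice_def)
  with \<pi> show ?thesis
    by (simp add: paths_def up_right_path_iff successively_append_iff up_right_step_def)
qed

lemma paths_append_up:
  assumes "\<pi> \<in> paths m n"
  shows "\<pi> @ [(m, Suc n)] \<in> paths m (Suc n)"
proof -
  have \<pi>: "\<pi> \<noteq> []" "set \<pi> \<subseteq> lattice" "hd \<pi> = (1,1)" "last \<pi> = (m,n)" "successively up_right_step \<pi>"
    using assms by (simp_all add: paths_def up_right_path_iff)
  have "(m,n) \<in> lattice" using \<pi> last_in_set[of \<pi>] by auto
  then have "(m, Suc n) \<in> lattice" by (simp add: lattice_def)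
  with \<pi> show ?thesis
    by (simp add: paths_def up_right_path_iff successively_append_iff up_right_step_def)
qed

lemma paths_nonempty:
  assumes "1 \<le> m" "1 \<le> n"
  shows "paths m n \<noteq> {}"
proof -
  have "[(1,1)] \<in> paths 1 1" by (simp add: paths_def up_right_path_iff lattice_def)
  moreover have "paths m 1 \<noteq> {}" if "paths 1 1 \<noteq> {}"
    using assms(1)
  proof (induction m rule: dec_induct)
    case (step k)
    then show ?case using paths_append_right[of _ k 1] by auto
  qed fact
  moreover have "paths m n \<noteq> {}" if "paths m 1 \<noteq> {}"
    using assms(2)
  proof (induction n rule: dec_induct)
    case (step k)
    then show ?case using paths_append_up[of _ m k] by auto
  qed fact
  ultimately show ?thesis by blast
qed

text \<open>The corner \<open>(m, n)\<close> and the origin \<open>(m + 1, n + 1)\<close> of the shifted rectangle differ by a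
  diagonal step; the point \<open>(m + 1, n)\<close> bridges it and meets neither of the two paths.\<close>
lemma paths_concat:
  assumes \<pi>: "\<pi> \<in> paths m n" and \<pi>': "\<pi>' \<in> paths m' n'"
  shows "\<pi> @ (Suc m, n) # map (\<lambda>p. (m + fst p, n + snd p)) \<pi>' \<in> paths (m + m') (n + n')"
proof -
  let ?s = "\<lambda>p. (m + fst p, n + snd p)"
  have 1: "\<pi> \<noteq> []" "set \<pi> \<subseteq> lattice" "hd \<pi> = (1,1)" "last \<pi> = (m,n)" "successively up_right_step \<pi>"
    and 2: "\<pi>' \<noteq> []" "set \<pi>' \<subseteq> lattice" "hd \<pi>' = (1,1)" "last \<pi>' = (m',n')" "successively up_right_step \<pi>'"
    using assms by (simp_all add: paths_def up_right_path_iff)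
  have "(m,n) \<in> lattice" using 1 last_in_set[of \<pi>] by auto
  then have n: "1 \<le> n" by (simp add: lattice_def)
  have "successively up_right_step (map ?s \<pi>')"
    unfolding successively_map by (rule successively_mono[OF 2(5)]) (auto simp: up_right_step_def)
  moreover have "hd (map ?s \<pi>') = (Suc m, Suc n)" using 2(1,3) by (simp add: hd_map)
  ultimately have "successively up_right_step ((Suc m, n) # map ?s \<pi>')"
    by (simp add: successively_Cons up_right_step_def)
  then have "successively up_right_step (\<pi> @ (Suc m, n) # map ?s \<pi>')"
    using 1 by (simp add: successively_append_iff up_right_step_def)
  moreover have "set (\<pi> @ (Suc m, n) # map ?s \<pi>') \<subseteq> lattice"
    using 1(2) 2(2) n by (auto simp: lattice_def)
  ultimately show ?thesis
    using 1 2 by (simp add: paths_def up_right_path_iff last_map)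
qed

lemma finite_path_supports: "finite (set ` paths m n)"
  by (rule finite_subset[of _ "Pow ({1..m} \<times> {1..n})"]) (use path_points_subset_box in auto)

text \<open>Maximising over the supports of the paths, instead of over the paths, makes finiteness
  immediate: supports are subsets of a rectangle.\<close>
lemma last_passage_eq_Max:
  "last_passage X m n \<omega> = Max ((\<lambda>S. \<Sum>p\<in>S. X p \<omega>) ` set ` paths m n)"
  by (simp add: last_passage_def image_image)

lemma last_passage_ge: "\<pi> \<in> paths m n \<Longrightarrow> (\<Sum>p\<in>set \<pi>. X p \<omega>) \<le> last_passage X m n \<omega>"
  unfolding last_passage_eq_Max by (rule Max_ge) (auto intro: finite_path_supports)

lemma last_passage_attained:
  assumes "1 \<le> m" "1 \<le> n"
  obtains \<pi> where "\<pi> \<in> paths m n" "last_passage X m n \<omega> = (\<Sum>p\<in>set \<pi>. X p \<omega>)"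
proof -
  have "last_passage X m n \<omega> \<in> (\<lambda>S. \<Sum>p\<in>S. X p \<omega>) ` set ` paths m n"
    unfolding last_passage_eq_Max
    by (rule Max_in) (use paths_nonempty[OF assms] in \<open>auto intro: finite_path_supports\<close>)
  then show ?thesis using that by auto
qed

lemma last_passage_mono:
  assumes nonneg: "\<And>p. p \<in> lattice \<Longrightarrow> 0 \<le> X p \<omega>" and "1 \<le> m" "1 \<le> n" "m \<le> m'"
  shows "last_passage X m n \<omega> \<le> last_passage X m' n \<omega>"
  using assms(4)
proof (induction m' rule: dec_induct)
  case (step k)
  obtain \<pi> where \<pi>: "\<pi> \<in> paths k n" "last_passage X k n \<omega> = (\<Sum>p\<in>set \<pi>. X p \<omega>)"
    by (rule last_passage_attained[of k n X \<omega>]) (use step assms in auto)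
  note \<pi>' = paths_append_right[OF \<pi>(1)]
  have "(\<Sum>p\<in>set \<pi>. X p \<omega>) \<le> (\<Sum>p\<in>set (\<pi> @ [(Suc k, n)]). X p \<omega>)"
    by (rule sum_mono2) (use \<pi>' in \<open>auto simp: paths_def up_right_path_iff intro!: nonneg\<close>)
  also have "\<dots> \<le> last_passage X (Suc k) n \<omega>" by (rule last_passage_ge[OF \<pi>'])
  finally show ?case using step \<pi> by simp
qed auto

text \<open>Concatenating two optimal paths gives a path that is at least as good as both together,
  since the bridging point has nonnegative weight.\<close>
lemma last_passage_superadditive:
  assumes nonneg: "\<And>p. p \<in> lattice \<Longrightarrow> 0 \<le> X p \<omega>"
    and "1 \<le> m" "1 \<le> n" "1 \<le> m'" "1 \<le> n'"
  shows "last_passage X m n \<omega> + last_passage (\<lambda>p. X (m + fst p, n + snd p)) m' n' \<omega>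
    \<le> last_passage X (m + m') (n + n') \<omega>"
proof -
  let ?s = "\<lambda>p. (m + fst p, n + snd p)"
  obtain \<pi> where \<pi>: "\<pi> \<in> paths m n" "last_passage X m n \<omega> = (\<Sum>p\<in>set \<pi>. X p \<omega>)"
    by (rule last_passage_attained[OF assms(2,3)])
  obtain \<pi>' where \<pi>': "\<pi>' \<in> paths m' n'"
    "last_passage (\<lambda>p. X (?s p)) m' n' \<omega> = (\<Sum>p\<in>set \<pi>'. X (?s p) \<omega>)"
    by (rule last_passage_attained[OF assms(4,5)])
  note c = paths_concat[OF \<pi>(1) \<pi>'(1)]
  have inj: "inj_on ?s (set \<pi>')" by (auto simp: inj_on_def prod_eq_iff)
  have disj: "set \<pi> \<inter> ?s ` set \<pi>' = {}"
    using path_points_subset_box[OF \<pi>(1)] path_points_subset_box[OF \<pi>'(1)] by force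
  have "(\<Sum>p\<in>set \<pi>. X p \<omega>) + (\<Sum>p\<in>set \<pi>'. X (?s p) \<omega>) = (\<Sum>p\<in>set \<pi> \<union> ?s ` set \<pi>'. X p \<omega>)"
    by (subst sum.union_disjoint) (auto simp: sum.reindex[OF inj] disj)
  also have "\<dots> \<le> (\<Sum>p\<in>set (\<pi> @ (Suc m, n) # map ?s \<pi>'). X p \<omega>)"
    by (rule sum_mono2) (use c in \<open>auto simp: paths_def up_right_path_iff intro!: nonneg\<close>)
  also have "\<dots> \<le> last_passage X (m + m') (n + n') \<omega>" by (rule last_passage_ge[OF c])
  finally show ?thesis using \<pi> \<pi>' by simp
qed

lemma last_passage_nonneg:
  assumes nonneg: "\<And>p. p \<in> lattice \<Longrightarrow> 0 \<le> X p \<omega>" and "1 \<le> m" "1 \<le> n"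
  shows "0 \<le> last_passage X m n \<omega>"
proof -
  obtain \<pi> where \<pi>: "\<pi> \<in> paths m n" "last_passage X m n \<omega> = (\<Sum>p\<in>set \<pi>. X p \<omega>)"
    by (rule last_passage_attained[OF assms(2,3)])
  then show ?thesis by (auto simp: paths_def up_right_path_iff intro!: sum_nonneg nonneg)
qed

lemma last_passage_measurable:
  assumes "\<And>p. p \<in> {1..m} \<times> {1..n} \<Longrightarrow> X p \<in> borel_measurable M"
  shows "last_passage X m n \<in> borel_measurable M"
proof -
  have "(\<lambda>\<omega>. Max ((\<lambda>S. \<Sum>p\<in>S. X p \<omega>) ` set ` paths m n)) \<in> borel_measurable M"
  proof (intro borel_measurable_Max finite_path_supports borel_measurable_sum)
    fix S p assume "S \<in> set ` paths m n" "p \<in> S"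
    then have "p \<in> {1..m} \<times> {1..n}" using path_points_subset_box by blast
    then show "X p \<in> borel_measurable M" by (rule assms)
  qed
  then show ?thesis unfolding last_passage_eq_Max[abs_def] .
qed

lemma last_passage_cong:
  assumes "\<And>p. p \<in> {1..m} \<times> {1..n} \<Longrightarrow> X p \<omega> = Y p \<omega>'"
  shows "last_passage X m n \<omega> = last_passage Y m n \<omega>'"
proof -
  have "(\<Sum>p\<in>set \<pi>. X p \<omega>) = (\<Sum>p\<in>set \<pi>. Y p \<omega>')" if "\<pi> \<in> paths m n" for \<pi>
    using path_points_subset_box[OF that] assms by (intro sum.cong) auto
  then show ?thesis unfolding last_passage_def by (simp cong: image_cong)
qed

section \<open>Borel-Cantelli arguments, a reflection principle and growth estimates\<close>

lemma limsup_ge_if_frequently: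
  fixes f :: "nat \<Rightarrow> ereal"
  assumes "\<And>n. \<exists>m\<ge>n. c \<le> f m"
  shows "c \<le> limsup f"
  unfolding limsup_INF_SUP
proof (rule INF_greatest)
  fix n :: nat
  obtain m where "m \<ge> n" "c \<le> f m" using assms by blast
  then show "c \<le> (SUP m\<in>{n..}. f m)" by (intro SUP_upper2[of m]) auto
qed

text \<open>A quantitative form of the second Borel-Cantelli lemma: the unions have probabilities tending
  to 1, since otherwise independence and \<open>1 - P (A k) \<le> exp (- P (A k))\<close> would bound the partial
  sums.\<close>
lemma (in prob_space) second_Borel_Cantelli_bound:
  assumes indep: "indep_sets F UNIV" and F: "\<And>k::nat. sigma_algebra (space M) (F k)"
    and A: "\<And>k. A k \<in> F k" and not_summable: "\<not> summable (\<lambda>k. prob (A k))"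
    and p: "0 < p" and r: "\<And>l. p * prob (\<Union>i<l. A (K + i)) \<le> r"
  shows "p \<le> r"
proof (rule ccontr)
  have A_events: "A k \<in> events" for k using A indep unfolding indep_sets_def by blast
  assume "\<not> p \<le> r"
  define q where "q = r / p"
  have q: "q < 1" using p \<open>\<not> p \<le> r\<close> by (simp add: q_def)
  have partial_sums: "(\<Sum>i<l. prob (A (i + K))) \<le> - ln (1 - q)" for l
  proof -
    let ?C = "\<lambda>k. space M - A k"
    have "?C k \<in> F k" for k
    proof -
      interpret sigma_algebra "space M" "F k" by (rule F)
      show ?thesis using A by (rule compl_sets)
    qed
    then have "prob (\<Inter>k\<in>{K..<K + Suc l}. ?C k) = (\<Prod>k\<in>{K..<K + Suc l}. prob (?C k))"
      by (intro indep_setsD[OF indep]) auto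
    also have "\<dots> \<le> (\<Prod>k\<in>{K..<K + Suc l}. exp (- prob (A k)))"
    proof (intro prod_mono conjI)
      fix k
      have "prob (?C k) = 1 - prob (A k)" using A_events by (rule prob_compl)
      then show "prob (?C k) \<le> exp (- prob (A k))" using exp_ge_add_one_self[of "- prob (A k)"] by simp
    qed simp
    also have "\<dots> = exp (- (\<Sum>k\<in>{K..<K + Suc l}. prob (A k)))"
      by (simp only: exp_sum[OF finite_atLeastLessThan] sum_negf[symmetric])
    also have "(\<Inter>k\<in>{K..<K + Suc l}. ?C k) = space M - (\<Union>i<Suc l. A (K + i))"
    proof -
      have "{K..<K + Suc l} = (\<lambda>i. K + i) ` {..<Suc l}"
        using image_add_atLeastLessThan[of K 0 "Suc l"] by (simp add: atLeast0LessThan add.commute)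
      then show ?thesis by auto
    qed
    also have "prob (space M - (\<Union>i<Suc l. A (K + i))) = 1 - prob (\<Union>i<Suc l. A (K + i))"
      using A_events by (intro prob_compl sets.finite_UN) auto
    finally have "1 - prob (\<Union>i<Suc l. A (K + i)) \<le> exp (- (\<Sum>k\<in>{K..<K + Suc l}. prob (A k)))" .
    moreover have "prob (\<Union>i<Suc l. A (K + i)) \<le> q"
      using r[of "Suc l"] p by (simp add: q_def field_simps)
    ultimately have "1 - q \<le> exp (- (\<Sum>k\<in>{K..<K + Suc l}. prob (A k)))" by linarith
    then have "exp (ln (1 - q)) \<le> exp (- (\<Sum>k\<in>{K..<K + Suc l}. prob (A k)))"
      using q by (subst exp_ln) auto
    then have "ln (1 - q) \<le> - (\<Sum>k\<in>{K..<K + Suc l}. prob (A k))"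
      by (simp only: exp_le_cancel_iff)
    moreover have "(\<Sum>k\<in>{K..<K + Suc l}. prob (A k)) = (\<Sum>i<Suc l. prob (A (i + K)))"
      using sum.shift_bounds_nat_ivl[of "\<lambda>k. prob (A k)" 0 K "Suc l"]
      by (simp add: atLeast0LessThan add.commute)
    moreover have "(\<Sum>i<l. prob (A (i + K))) \<le> (\<Sum>i<Suc l. prob (A (i + K)))" by simp
    ultimately show ?thesis by linarith
  qed
  have "summable (\<lambda>i. prob (A (i + K)))"
  proof (rule bounded_imp_summable)
    fix l
    show "(\<Sum>i\<le>l. prob (A (i + K))) \<le> - ln (1 - q)"
      using partial_sums[of "Suc l"] unfolding lessThan_Suc_atMost .
  qed simp
  then show False using not_summable by (simp add: summable_iff_shift[of "\<lambda>k. prob (A k)" K])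
qed

text \<open>A reflection principle. Splitting the union of the \<open>A i\<close> according to the first \<open>A i\<close> that
  occurs makes it a disjoint union, and on each part the event \<open>B i\<close> is still unaffected by what has
  been observed.\<close>
lemma (in prob_space) prob_UN_Int_ge:
  assumes A: "\<And>i. i < n \<Longrightarrow> A i \<in> events" and B: "\<And>i. i < n \<Longrightarrow> B i \<in> events"
    and indep: "\<And>i. i < n \<Longrightarrow> prob (disjointed A i \<inter> B i) = prob (disjointed A i) * prob (B i)"
    and p: "\<And>i. i < n \<Longrightarrow> p \<le> prob (B i)"
  shows "p * prob (\<Union>i<n. A i) \<le> prob (\<Union>i<n. A i \<inter> B i)"
proof -
  let ?D = "disjointed A"
  have D: "i < n \<Longrightarrow> ?D i \<in> events" for i
    unfolding disjointed_def using A by (intro sets.Diff sets.finite_UN) auto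
  have disj: "disjoint_family_on ?D {..<n}"
    using disjoint_family_disjointed[of A] by (rule disjoint_family_on_mono[rotated]) auto
  then have disj': "disjoint_family_on (\<lambda>i. ?D i \<inter> B i) {..<n}"
    by (auto simp: disjoint_family_on_def)
  have "(\<Union>i<n. A i) = (\<Union>i<n. ?D i)"
    using finite_UN_disjointed_eq[of A n] by (simp add: atLeast0LessThan)
  then have "prob (\<Union>i<n. A i) = (\<Sum>i<n. prob (?D i))"
    using D disj by (simp add: finite_measure_finite_Union image_subset_iff)
  then have "p * prob (\<Union>i<n. A i) = (\<Sum>i<n. p * prob (?D i))"
    by (simp add: sum_distrib_left)
  also have "\<dots> \<le> (\<Sum>i<n. prob (?D i \<inter> B i))"
    by (rule sum_mono) (use p in \<open>simp add: indep mult.commute[of p] mult_left_mono\<close>)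
  also have "\<dots> = prob (\<Union>i<n. ?D i \<inter> B i)"
    using D B disj' by (intro finite_measure_finite_Union[symmetric]) (simp_all add: image_subset_iff sets.Int)
  also have "\<dots> \<le> prob (\<Union>i<n. A i \<inter> B i)"
  proof (rule finite_measure_mono)
    show "(\<Union>i<n. ?D i \<inter> B i) \<subseteq> (\<Union>i<n. A i \<inter> B i)"
      using disjointed_subset[of A] by blast
    show "(\<Union>i<n. A i \<inter> B i) \<in> events" using A B by (intro sets.finite_UN sets.Int) auto
  qed
  finally show ?thesis .
qed

lemma Suc_mult_power_self_le: "Suc k * k ^ k \<le> Suc k ^ Suc k"
  by (simp add: power_mono del: mult_Suc)

text \<open>Along \<open>k ^ k\<close> the previous term is negligible against the next one, while \<open>ln (ln (k ^ k))\<close>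
  is asymptotic to \<open>ln k\<close>. So a threshold with constant \<open>\<kappa>\<close> for the increments dominates the one
  with constant \<open>c < \<kappa>\<close> for the passage times, even after subtracting a term of order \<open>k\<close>.\<close>
lemma eventually_threshold_le:
  fixes b c \<kappa> w :: real
  assumes "0 < b" "0 < c" "c < \<kappa>" and w: "0 \<le> w"
  shows "eventually (\<lambda>k. c * ln (ln (Suc k ^ Suc k)) powr (2/3) * b * (Suc k ^ Suc k) powr (1/3)
    \<le> \<kappa> * ln k powr (2/3) * b * real (Suc k ^ Suc k - k ^ k) powr (1/3) - w * k) sequentially"
proof -
  define N where "N k = k ^ k" for k :: nat
  define d where "d k = N (Suc k) - N k" for k
  have "eventually (\<lambda>k. c * ln (ln (N (Suc k))) powr (2/3) * b * N (Suc k) powr (1/3)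
    \<le> \<kappa> * ln k powr (2/3) * b * d k powr (1/3) - w * k) sequentially"
  proof -
    define u v where "u = c * b" and "v = \<kappa> * b"
    have uv: "0 < v" "u < v" using assms(1-3) by (auto simp: u_def v_def)
    have "(\<lambda>k::nat. (v * ln (real k) powr (2/3) * (real k / (real k + 1)) powr (1/3) - w * real k / (real k + 1) powr (5/3))
        / ln ((real k + 1) * ln (real k + 1)) powr (2/3)) \<longlonglongrightarrow> v"
      using uv by real_asymp
    from order_tendstoD(1)[OF this uv(2)] show ?thesis
      using eventually_ge_at_top[of 4]
    proof eventually_elim
      case (elim k)
      let ?n = "real k + 1" and ?N = "real (N (Suc k))"
      have N: "?N = ?n ^ Suc k" unfolding N_def by (simp only: of_nat_power of_nat_Suc add.commute)
      have lnln: "ln (ln ?N) = ln (?n * ln ?n)" unfolding N by (subst ln_realpow) (auto simp: add.commute)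
      have "1 < ln ?n * ?n"
      proof -
        have "exp 1 < ?n" using elim(2) e_less_272 by simp
        then have "1 < ln ?n" using elim(2) by (subst exp_less_cancel_iff[symmetric]) simp
        then show ?thesis using elim(2) by (intro less_1_mult) auto
      qed
      then have "0 < ln (?n * ln ?n)" by (simp add: mult.commute)
      then have "u * ln (?n * ln ?n) powr (2/3)
          < v * ln (real k) powr (2/3) * (real k / ?n) powr (1/3) - w * real k / ?n powr (5/3)"
        using elim(1) by (simp add: field_simps)
      then have "u * ln (?n * ln ?n) powr (2/3) * ?N powr (1/3)
          \<le> (v * ln (real k) powr (2/3) * (real k / ?n) powr (1/3) - w * real k / ?n powr (5/3)) * ?N powr (1/3)"
        by (intro mult_right_mono) auto
      also have "\<dots> = v * ln (real k) powr (2/3) * ((real k / ?n) powr (1/3) * ?N powr (1/3))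
          - w * real k * (?N powr (1/3) / ?n powr (5/3))"
        by (simp add: algebra_simps)
      also have "\<dots> \<le> v * ln (real k) powr (2/3) * d k powr (1/3) - w * real k * 1"
      proof (intro diff_mono mult_left_mono)
        have "?n * N k \<le> ?N" using Suc_mult_power_self_le[of k] unfolding N_def
          by (metis of_nat_Suc of_nat_le_iff of_nat_mult add.commute)
        then have "real k * ?N \<le> ?n * (?N - N k)" by (simp add: algebra_simps)
        moreover have "real (d k) = ?N - N k"
        proof -
          have "N k \<le> N (Suc k)" using Suc_mult_power_self_le[of k] by (simp add: N_def)
          then show ?thesis by (simp add: d_def of_nat_diff)
        qed
        ultimately have "real k * ?N \<le> ?n * d k" by (simp only:)
        then have "real k / ?n * ?N \<le> d k" by (simp add: pos_divide_le_eq mult.commute)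
        then show "(real k / ?n) powr (1/3) * ?N powr (1/3) \<le> d k powr (1/3)"
          by (subst powr_mult[symmetric]) (auto intro!: powr_mono2)
        have "?n ^ 5 \<le> ?N" unfolding N using elim(2) by (intro power_increasing) auto
        then have "(?n ^ 5) powr (1/3) \<le> ?N powr (1/3)" by (intro powr_mono2) auto
        moreover have "(?n ^ 5) powr (1/3) = ?n powr (5/3)"
          by (subst powr_numeral[symmetric]) (simp_all only: powr_powr, simp_all)
        ultimately show "1 \<le> ?N powr (1/3) / ?n powr (5/3)" by simp
      qed (use uv w in auto)
      finally show ?case unfolding lnln d_def u_def v_def by (simp add: mult_ac)
    qed
  qed
  then show ?thesis unfolding d_def N_def .
qed

section \<open>Superadditive processes over independent rows\<close>

locale independent_rows = prob_space M for M :: "'w measure" +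
  fixes E :: "nat \<Rightarrow> 'w set set"
  assumes row_sigma_algebra: "sigma_algebra (space M) (E j)"
    and rows_indep: "indep_sets E UNIV"
begin

text \<open>The \<open>\<sigma>\<close>-algebra of the events that depend only on the rows in \<open>J\<close>.\<close>
definition window :: "nat set \<Rightarrow> 'w set set" where
  "window J = sigma_sets (space M) (\<Union>j\<in>J. E j)"

lemma row_subset_events: "E j \<subseteq> events"
  using rows_indep by (simp add: indep_sets_def)

lemma row_subset_Pow: "(\<Union>j\<in>J. E j) \<subseteq> Pow (space M)"
  by (intro UN_least order_trans[OF row_subset_events sets.space_closed])

lemma window_events: "window J \<subseteq> events"
  unfolding window_def using row_subset_events by (intro sets.sigma_sets_subset UN_least)

lemma window_mono: "J \<subseteq> K \<Longrightarrow> window J \<subseteq> window K"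
  unfolding window_def by (intro sigma_sets_mono') auto

lemma in_window_mono: "S \<in> window J \<Longrightarrow> J \<subseteq> K \<Longrightarrow> S \<in> window K"
  by (rule subsetD[OF window_mono])

lemma sigma_algebra_window: "sigma_algebra (space M) (window J)"
  unfolding window_def by (rule sigma_algebra_sigma_sets) (rule row_subset_Pow)

lemma Int_stable_row: "Int_stable (E j)"
proof -
  interpret sigma_algebra "space M" "E j" by (rule row_sigma_algebra)
  show ?thesis unfolding Int_stable_def by blast
qed

lemma windows_indep:
  assumes "disjoint_family J"
  shows "indep_sets (\<lambda>k. window (J k)) UNIV"
  unfolding window_def
proof (rule indep_sets_collect_sigma)
  show "indep_sets E (\<Union>k\<in>UNIV. J k)"
    by (rule indep_sets_mono_index[OF subset_UNIV rows_indep])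
qed (use assms Int_stable_row in simp_all)

lemma prob_Int_window:
  assumes "J \<inter> K = {}" "S \<in> window J" "T \<in> window K"
  shows "prob (S \<inter> T) = prob S * prob T"
proof -
  let ?J = "\<lambda>k::nat. if k = 0 then J else if k = 1 then K else {}"
  have "disjoint_family ?J" using assms(1) by (auto simp: disjoint_family_on_def)
  from indep_setsD[OF windows_indep[OF this], of "{0,1}" "\<lambda>k. if k = 0 then S else T"]
  show ?thesis using assms(2,3) by (simp add: Int_commute)
qed

end

text \<open>These are the only properties of last passage times that the law of the iterated logarithm
  uses; the geometry of the paths enters through superadditivity alone.\<close>
locale superadditive_passage = independent_rows M E for M :: "'w measure" and E +
  fixes G :: "nat \<Rightarrow> nat \<Rightarrow> 'w \<Rightarrow> real" and a b x0 \<delta> C :: real and N0 :: nat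
  assumes G_window: "s \<le> t \<Longrightarrow> {\<omega> \<in> space M. y \<le> G s t \<omega>} \<in> window {s<..t}"
    and G_nonneg: "AE \<omega> in M. \<forall>s. 0 \<le> G 0 s \<omega>"
    and superadditive: "AE \<omega> in M. \<forall>s t. s \<le> t \<longrightarrow> G 0 s \<omega> + G s t \<omega> \<le> G 0 t \<omega>"
    and stationary: "s < t \<Longrightarrow> \<P>(\<omega> in M. y \<le> G s t \<omega>) = \<P>(\<omega> in M. y \<le> G 0 (t - s) \<omega>)"
    and b_pos: "0 < b" and x0: "1 < x0" and \<delta>_pos: "0 < \<delta>" and C_pos: "0 < C"
    and tail: "N0 \<le> N \<Longrightarrow> x0 \<le> x \<Longrightarrow> x \<le> \<delta> * real N powr (1/3) \<Longrightarrow>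
      0 < \<P>(\<omega> in M. a * N + x * b * N powr (1/3) \<le> G 0 N \<omega>) \<and>
      \<bar>ln (\<P>(\<omega> in M. a * N + x * b * N powr (1/3) \<le> G 0 N \<omega>)) + 4/3 * x powr (3/2)\<bar>
        \<le> C * (x\<^sup>2 * N powr (-1/3) + ln x)"
begin

lemma G_events: "s \<le> t \<Longrightarrow> {\<omega> \<in> space M. y \<le> G s t \<omega>} \<in> events"
  using G_window window_events by blast

text \<open>At level \<open>x = \<kappa> * ln k powr (2/3)\<close> the main term \<open>4/3 * x powr (3/2)\<close> is exactly
  \<open>\<theta> * ln k\<close>, and the error terms in the tail bound are \<open>o (ln k)\<close> as soon as \<open>L k\<close> is at least of
  order \<open>k\<close>.\<close>
lemma tail_estimate:
  fixes L :: "nat \<Rightarrow> nat"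
  assumes "0 < \<kappa>" "0 < \<epsilon>" and L: "eventually (\<lambda>k. k \<le> L k) sequentially"
  defines "\<theta> \<equiv> 4/3 * \<kappa> powr (3/2)"
    and "P \<equiv> \<lambda>k. \<P>(\<omega> in M. a * L k + \<kappa> * ln k powr (2/3) * b * L k powr (1/3) \<le> G 0 (L k) \<omega>)"
  shows "eventually (\<lambda>k. real k powr - (\<theta> + \<epsilon>) \<le> P k \<and> P k \<le> real k powr - (\<theta> - \<epsilon>)) sequentially"
proof -
  have "filterlim (\<lambda>k::nat. \<kappa> * ln (real k) powr (2/3)) at_top sequentially"
    using \<open>0 < \<kappa>\<close> by real_asymp
  then have 1: "eventually (\<lambda>k::nat. x0 \<le> \<kappa> * ln (real k) powr (2/3)) sequentially"
    by (simp add: filterlim_at_top)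
  have "(\<lambda>k::nat. \<kappa> * ln (real k) powr (2/3) / real k powr (1/3)) \<longlonglongrightarrow> 0"
    using \<open>0 < \<kappa>\<close> by real_asymp
  from order_tendstoD(2)[OF this \<delta>_pos]
  have 2: "eventually (\<lambda>k::nat. \<kappa> * ln (real k) powr (2/3) / real k powr (1/3) < \<delta>) sequentially" .
  have "(\<lambda>k::nat. C * ((\<kappa> * ln (real k) powr (2/3))\<^sup>2 * real k powr (-1/3)
      + ln (\<kappa> * ln (real k) powr (2/3))) / ln (real k)) \<longlonglongrightarrow> 0"
    using \<open>0 < \<kappa>\<close> C_pos by real_asymp
  from order_tendstoD(2)[OF this \<open>0 < \<epsilon>\<close>]
  have 3: "eventually (\<lambda>k::nat. C * ((\<kappa> * ln (real k) powr (2/3))\<^sup>2 * real k powr (-1/3)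
      + ln (\<kappa> * ln (real k) powr (2/3))) / ln (real k) < \<epsilon>) sequentially" .
  show ?thesis
    using 1 2 3 L eventually_ge_at_top[of N0] eventually_gt_at_top[of 1]
  proof eventually_elim
    case (elim k)
    let ?x = "\<kappa> * ln (real k) powr (2/3)"
    have k: "0 < real k" "0 < ln (real k)" using elim by auto
    have Lk: "real k \<le> real (L k)" using elim by simp
    have "?x < \<delta> * real k powr (1/3)" using elim(2) k by (simp add: field_simps)
    also have "\<dots> \<le> \<delta> * real (L k) powr (1/3)"
      using Lk \<delta>_pos k by (intro mult_left_mono powr_mono2) auto
    finally have "?x \<le> \<delta> * real (L k) powr (1/3)" by simp
    note t = tail[of "L k" ?x, OF _ elim(1) this]
    have "?x powr (3/2) = \<kappa> powr (3/2) * ln k"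
      using k \<open>0 < \<kappa>\<close> by (simp add: powr_mult powr_powr)
    moreover have "0 < P k" "\<bar>ln (P k) + 4/3 * ?x powr (3/2)\<bar> \<le> C * (?x\<^sup>2 * L k powr (-1/3) + ln ?x)"
      using t elim unfolding P_def by simp_all
    moreover have "C * (?x\<^sup>2 * L k powr (-1/3) + ln ?x) \<le> C * (?x\<^sup>2 * k powr (-1/3) + ln ?x)"
      using C_pos Lk k by (intro mult_left_mono add_right_mono powr_mono2') auto
    moreover have "C * (?x\<^sup>2 * k powr (-1/3) + ln ?x) \<le> \<epsilon> * ln k"
      using elim(3) k by (simp add: field_simps)
    ultimately have "0 < P k" "\<bar>ln (P k) + \<theta> * ln k\<bar> \<le> \<epsilon> * ln k"
      unfolding \<theta>_def by (simp_all add: mult.assoc)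
    then have "- (\<theta> + \<epsilon>) * ln k \<le> ln (P k)" "ln (P k) \<le> - (\<theta> - \<epsilon>) * ln k"
      by (auto simp: abs_le_iff algebra_simps)
    then have "exp (- (\<theta> + \<epsilon>) * ln k) \<le> exp (ln (P k))"
      "exp (ln (P k)) \<le> exp (- (\<theta> - \<epsilon>) * ln k)"
      by (simp_all only: exp_le_cancel_iff)
    then show ?case using k \<open>0 < P k\<close> by (simp add: powr_def)
  qed
qed

text \<open>The tail bound at the smallest admissible level \<open>x0\<close> replaces a lower tail estimate: its
  right-hand side stays bounded as \<open>N\<close> grows.\<close>
lemma central_probability:
  obtains p N1 where "0 < p" "\<And>N. N1 \<le> N \<Longrightarrow> p \<le> \<P>(\<omega> in M. a * N \<le> G 0 N \<omega>)"
proof -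
  have "filterlim (\<lambda>N::nat. \<delta> * real N powr (1/3)) at_top sequentially"
    using \<delta>_pos by real_asymp
  then have "eventually (\<lambda>N::nat. x0 \<le> \<delta> * real N powr (1/3)) sequentially"
    by (simp add: filterlim_at_top)
  then have "eventually (\<lambda>N::nat. exp (- 4/3 * x0 powr (3/2) - C * (x0\<^sup>2 + ln x0))
      \<le> \<P>(\<omega> in M. a * N \<le> G 0 N \<omega>)) sequentially"
    using eventually_ge_at_top[of N0] eventually_ge_at_top[of 1]
  proof eventually_elim
    case (elim N)
    let ?P = "\<P>(\<omega> in M. a * N + x0 * b * N powr (1/3) \<le> G 0 N \<omega>)"
    have t: "0 < ?P" "\<bar>ln ?P + 4/3 * x0 powr (3/2)\<bar> \<le> C * (x0\<^sup>2 * N powr (-1/3) + ln x0)"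
      using tail[of N x0] elim by auto
    have "real N powr (-1/3) \<le> 1 powr (-1/3)" using elim by (intro powr_mono2') auto
    then have "x0\<^sup>2 * N powr (-1/3) \<le> x0\<^sup>2 * 1" by (intro mult_left_mono) auto
    then have "C * (x0\<^sup>2 * N powr (-1/3) + ln x0) \<le> C * (x0\<^sup>2 + ln x0)"
      using C_pos by (intro mult_left_mono) auto
    then have "- 4/3 * x0 powr (3/2) - C * (x0\<^sup>2 + ln x0) \<le> ln ?P"
      using t(2) unfolding abs_le_iff by linarith
    then have "exp (- 4/3 * x0 powr (3/2) - C * (x0\<^sup>2 + ln x0)) \<le> ?P"
      using t(1) by (simp only: ln_ge_iff)
    also have "?P \<le> \<P>(\<omega> in M. a * N \<le> G 0 N \<omega>)"
      by (intro finite_measure_mono G_events) (use x0 b_pos in \<open>auto intro: order_trans[rotated]\<close>)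
    finally show ?case .
  qed
  then obtain N1 where "\<And>N. N1 \<le> N \<Longrightarrow> exp (- 4/3 * x0 powr (3/2) - C * (x0\<^sup>2 + ln x0))
      \<le> \<P>(\<omega> in M. a * N \<le> G 0 N \<omega>)"
    unfolding eventually_sequentially by blast
  then show ?thesis by (rule that[OF exp_gt_zero])
qed

text \<open>At the first index \<open>n\<close> of the block with an excess, the passage time from \<open>n\<close> to \<open>t + N1\<close>
  is independent of the past and is at least \<open>a * (t + N1 - n)\<close> with probability at least \<open>p\<close>; the
  excess then survives until \<open>t + N1\<close>. The margin \<open>N1\<close> keeps the remaining distance in the range where
  \<open>p\<close> is available.\<close>
lemma maximal_inequality:
  assumes p: "0 < p" "\<And>N. N1 \<le> N \<Longrightarrow> p \<le> \<P>(\<omega> in M. a * N \<le> G 0 N \<omega>)" and "1 \<le> N1"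
  shows "p * \<P>(\<omega> in M. \<exists>n\<in>{s..<t}. a * n + y \<le> G 0 n \<omega>)
    \<le> \<P>(\<omega> in M. a * real (t + N1) + y \<le> G 0 (t + N1) \<omega>)"
proof -
  let ?L = "t + N1"
  define A where "A i = {\<omega> \<in> space M. a * real (s + i) + y \<le> G 0 (s + i) \<omega>}" for i
  define B where "B i = {\<omega> \<in> space M. a * real (?L - (s + i)) \<le> G (s + i) ?L \<omega>}" for i
  let ?J = "\<lambda>i. {0<..s + i}" and ?K = "\<lambda>i. {s + i<..?L}"
  have A: "A i \<in> window (?J i)" for i
    unfolding A_def using G_window[of 0 "s + i"] by auto
  have B: "B i \<in> window (?K i)" if "i < t - s" for i
    unfolding B_def using that by (intro G_window) auto
  have D: "disjointed A i \<in> window (?J i)" for i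
  proof -
    interpret sigma_algebra "space M" "window (?J i)" by (rule sigma_algebra_window)
    have "A j \<in> window (?J i)" if "j \<le> i" for j
      using that by (intro in_window_mono[OF A]) auto
    then show ?thesis unfolding disjointed_def by (intro Diff finite_UN) auto
  qed
  have "p * prob (\<Union>i<t - s. A i) \<le> prob (\<Union>i<t - s. A i \<inter> B i)"
  proof (rule prob_UN_Int_ge)
    fix i assume i: "i < t - s"
    show "A i \<in> events" "B i \<in> events" using A B[OF i] window_events by auto
    show "prob (disjointed A i \<inter> B i) = prob (disjointed A i) * prob (B i)"
      by (rule prob_Int_window[OF _ D B[OF i]]) auto
    have "prob (B i) = \<P>(\<omega> in M. a * real (?L - (s + i)) \<le> G 0 (?L - (s + i)) \<omega>)"
      unfolding B_def using i by (intro stationary) auto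
    also have "p \<le> \<dots>" using i p(2)[of "?L - (s + i)"] by auto
    finally show "p \<le> prob (B i)" .
  qed
  also have "\<dots> \<le> \<P>(\<omega> in M. a * real ?L + y \<le> G 0 ?L \<omega>)"
  proof (rule finite_measure_mono_AE)
    show "AE \<omega> in M. \<omega> \<in> (\<Union>i<t - s. A i \<inter> B i) \<longrightarrow> \<omega> \<in> {\<omega> \<in> space M. a * real ?L + y \<le> G 0 ?L \<omega>}"
      using superadditive
    proof (eventually_elim, safe)
      fix \<omega> i
      assume super: "\<forall>s t. s \<le> t \<longrightarrow> G 0 s \<omega> + G s t \<omega> \<le> G 0 t \<omega>"
        and i: "i < t - s" and "\<omega> \<in> A i" "\<omega> \<in> B i"
      then have "a * real (s + i) + y \<le> G 0 (s + i) \<omega>" "a * real (?L - (s + i)) \<le> G (s + i) ?L \<omega>" "\<omega> \<in> space M"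
        by (auto simp: A_def B_def)
      moreover have "G 0 (s + i) \<omega> + G (s + i) ?L \<omega> \<le> G 0 ?L \<omega>" using super i by simp
      moreover have "a * real (s + i) + a * real (?L - (s + i)) = a * real ?L"
        unfolding distrib_left[symmetric] of_nat_add[symmetric] using i by simp
      ultimately show "a * real ?L + y \<le> G 0 ?L \<omega>" by linarith
      show "\<omega> \<in> space M" by fact
    qed
    show "{\<omega> \<in> space M. a * real ?L + y \<le> G 0 ?L \<omega>} \<in> events" by (rule G_events) simp
  qed
  also have "(\<Union>i<t - s. A i) = {\<omega> \<in> space M. \<exists>n\<in>{s..<t}. a * n + y \<le> G 0 n \<omega>}"
  proof (intro set_eqI iffI)
    fix \<omega> assume "\<omega> \<in> {\<omega> \<in> space M. \<exists>n\<in>{s..<t}. a * n + y \<le> G 0 n \<omega>}"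
    then obtain n where "s \<le> n" "n < t" "a * n + y \<le> G 0 n \<omega>" "\<omega> \<in> space M" by auto
    then have "\<omega> \<in> A (n - s)" "n - s < t - s" by (auto simp: A_def)
    then show "\<omega> \<in> (\<Union>i<t - s. A i)" by blast
  next
    fix \<omega> assume "\<omega> \<in> (\<Union>i<t - s. A i)"
    then obtain i where "i < t - s" "\<omega> \<in> A i" by blast
    then show "\<omega> \<in> {\<omega> \<in> space M. \<exists>n\<in>{s..<t}. a * n + y \<le> G 0 n \<omega>}"
      unfolding A_def by (auto intro!: bexI[of _ "s + i"])
  qed
  finally show ?thesis .
qed

section \<open>The upper bound\<close>

text \<open>The constant \<open>\<kappa>\<close> between \<open>(3/4) powr (2/3)\<close> and \<open>c\<close> makes the probabilities of the blocks
  summable. The ratio \<open>\<rho> = c / \<kappa>\<close> of the blocks is the one for which the loss from comparing an index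
  in the block with the end of the block is still smaller than the gain from \<open>\<kappa>\<close> to \<open>c\<close>.\<close>
lemma AE_eventually_less:
  assumes c: "(3/4) powr (2/3) < c"
  shows "AE \<omega> in M. eventually (\<lambda>n. G 0 n \<omega> < a * n + c * ln (ln n) powr (2/3) * b * n powr (1/3)) sequentially"
proof -
  obtain p N1' where p: "0 < p" "\<And>N. N1' \<le> N \<Longrightarrow> p \<le> \<P>(\<omega> in M. a * N \<le> G 0 N \<omega>)"
    by (rule central_probability) blast
  define N1 where "N1 = max 1 N1'"
  have "\<exists>\<kappa>. c0 < \<kappa> \<and> 0 < \<kappa> \<and> \<kappa> < c" if "0 < c0" "c0 < c" for c0 :: real
    using dense[OF that(2)] that by force
  from this[OF _ c] obtain \<kappa> where \<kappa>: "(3/4) powr (2/3) < \<kappa>" "0 < \<kappa>" "\<kappa> < c"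
    by auto
  define \<rho> where "\<rho> = c / \<kappa>"
  have \<rho>: "1 < \<rho>" using \<kappa> by (simp add: \<rho>_def)
  define s where "s k = nat \<lceil>\<rho> ^ k\<rceil>" for k
  define L where "L k = s (Suc k) + N1" for k
  define y where "y k = \<kappa> * ln k powr (2/3) * b * L k powr (1/3)" for k
  define F where "F k = {\<omega> \<in> space M. \<exists>n\<in>{s k..<s (Suc k)}. a * n + y k \<le> G 0 n \<omega>}" for k
  define P where "P k = \<P>(\<omega> in M. a * L k + \<kappa> * ln k powr (2/3) * b * L k powr (1/3) \<le> G 0 (L k) \<omega>)" for k
  have s_ge: "\<rho> ^ k \<le> s k" for k unfolding s_def by linarith
  have s_le: "s k \<le> \<rho> ^ k + 1" for k
    using \<rho> by (simp add: s_def)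
  have s_mono: "s j \<le> s k" if "j \<le> k" for j k
    unfolding s_def using \<rho> that by (intro nat_mono ceiling_mono power_increasing) auto

  have "((3/4) powr (2/3)) powr (3/2) < \<kappa> powr (3/2)" using \<kappa> by (intro powr_less_mono2) auto
  then have \<theta>: "1 < 4/3 * \<kappa> powr (3/2)" by (simp add: powr_powr)
  define \<epsilon> where "\<epsilon> = (4/3 * \<kappa> powr (3/2) - 1) / 2"
  have \<epsilon>: "0 < \<epsilon>" "- (4/3 * \<kappa> powr (3/2) - \<epsilon>) < -1" using \<theta> by (auto simp: \<epsilon>_def field_simps)
  have "eventually (\<lambda>k::nat. real k \<le> \<rho> ^ k) sequentially" using \<rho> by real_asymp
  then have "eventually (\<lambda>k. k \<le> L k) sequentially"
  proof eventually_elim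
    case (elim k)
    then have "real k \<le> s k" using s_ge[of k] by linarith
    then show ?case using s_mono[of k "Suc k"] by (simp add: L_def)
  qed
  from tail_estimate[OF \<kappa>(2) \<epsilon>(1) this]
  have "eventually (\<lambda>k. norm (prob (F k)) \<le> 1/p * real k powr - (4/3 * \<kappa> powr (3/2) - \<epsilon>)) sequentially"
  proof eventually_elim
    case (elim k)
    have "p * prob (F k) \<le> P k"
      unfolding F_def P_def L_def
      using maximal_inequality[of p N1 "s k" "s (Suc k)" "y k"] p
      by (simp add: N1_def y_def L_def)
    also have "\<dots> \<le> real k powr - (4/3 * \<kappa> powr (3/2) - \<epsilon>)" using elim unfolding P_def by blast
    finally show ?case using p(1) by (simp add: field_simps)
  qed
  then have summable: "summable (\<lambda>k. prob (F k))"
    by (rule summable_comparison_test_ev) (use \<epsilon> in \<open>intro summable_mult, simp add: summable_real_powr_iff\<close>)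
  have F: "F k \<in> events" for k
  proof -
    have "F k = (\<Union>n\<in>{s k..<s (Suc k)}. {\<omega> \<in> space M. a * n + y k \<le> G 0 n \<omega>})"
      unfolding F_def by blast
    then show ?thesis by (auto intro!: sets.finite_UN G_events)
  qed
  have BC: "AE \<omega> in M. eventually (\<lambda>k. \<omega> \<in> space M - F k) sequentially"
    using F summable by (intro borel_cantelli_AE1) (auto simp: less_top[symmetric])

  define l where "l = ln \<rho>"
  define r where "r = \<rho> powr (1/2)"
  have l: "0 < l" using \<rho> by (simp add: l_def)
  have r: "1 < r" unfolding r_def using \<rho> by (simp add: gr_one_powr)
  (* The power 1/3 turns L k < rho^(k+2) into a factor rho^(2/3); the remaining rho^(1/3) absorbs
     the difference between ln k and ln (k * l), where k * l is the logarithm of rho^k. *)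
  have y_le: "eventually (\<lambda>k. y k \<le> c * ln (k * l) powr (2/3) * b * (\<rho> ^ k) powr (1/3)) sequentially"
  proof -
    have "eventually (\<lambda>k::nat. \<rho> ^ Suc k + (1 + N1) \<le> \<rho> ^ (k + 2)) sequentially"
      using \<rho> by real_asymp
    moreover have "eventually (\<lambda>k::nat. ln (real k) \<le> r * ln (k * l)) sequentially"
      using l r by real_asymp
    moreover have "eventually (\<lambda>k::nat. 1 \<le> k * l) sequentially"
      using l by real_asymp
    ultimately show ?thesis
      using eventually_gt_at_top[of 1]
    proof eventually_elim
      case (elim k)
      have "real (L k) \<le> \<rho> ^ Suc k + (1 + N1)" using s_le[of "Suc k"] by (simp add: L_def)
      then have "real (L k) powr (1/3) \<le> (\<rho> ^ (k + 2)) powr (1/3)"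
        using elim by (intro powr_mono2) auto
      also have "\<dots> = (\<rho> ^ k) powr (1/3) * \<rho> powr (2/3)"
      proof -
        have "\<rho> ^ (k + 2) = \<rho> ^ k * \<rho> powr 2" using \<rho> by (simp add: power2_eq_square)
        then show ?thesis using \<rho> by (simp only: powr_mult powr_powr) simp
      qed
      finally have 1: "real (L k) powr (1/3) \<le> (\<rho> ^ k) powr (1/3) * \<rho> powr (2/3)" .
      have "ln k powr (2/3) \<le> (r * ln (k * l)) powr (2/3)"
        using elim by (intro powr_mono2) auto
      also have "\<dots> = \<rho> powr (1/3) * ln (k * l) powr (2/3)"
        using elim \<rho> by (simp add: powr_mult r_def powr_powr)
      finally have "ln k powr (2/3) * real (L k) powr (1/3)
          \<le> (\<rho> powr (1/3) * ln (k * l) powr (2/3)) * ((\<rho> ^ k) powr (1/3) * \<rho> powr (2/3))"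
        using 1 by (intro mult_mono) auto
      also have "\<dots> = (\<rho> powr (1/3) * \<rho> powr (2/3)) * ln (k * l) powr (2/3) * (\<rho> ^ k) powr (1/3)"
        by (simp add: mult_ac)
      also have "\<rho> powr (1/3) * \<rho> powr (2/3) = \<rho>" using \<rho> by (simp flip: powr_add)
      finally have "\<kappa> * b * (ln k powr (2/3) * real (L k) powr (1/3))
          \<le> \<kappa> * b * (\<rho> * ln (k * l) powr (2/3) * (\<rho> ^ k) powr (1/3))"
        using \<kappa> b_pos by (intro mult_left_mono) auto
      moreover have "c = \<kappa> * \<rho>" using \<kappa> by (simp add: \<rho>_def)
      ultimately show ?case by (simp add: y_def mult_ac)
    qed
  qed
  have l1: "eventually (\<lambda>k::nat. 1 \<le> k * l) sequentially" using l by real_asymp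
  show ?thesis
    using BC
  proof eventually_elim
    case (elim \<omega>)
    have "eventually (\<lambda>k. \<omega> \<in> space M - F k \<and> 1 \<le> k * l \<and>
        y k \<le> c * ln (k * l) powr (2/3) * b * (\<rho> ^ k) powr (1/3)) sequentially"
      by (intro eventually_conj elim y_le l1)
    then obtain K where K: "\<And>k. K \<le> k \<Longrightarrow> \<omega> \<in> space M - F k \<and> 1 \<le> k * l \<and>
        y k \<le> c * ln (k * l) powr (2/3) * b * (\<rho> ^ k) powr (1/3)"
      unfolding eventually_sequentially by blast
    show ?case
    proof (rule eventually_sequentiallyI[of "s K"])
      fix n assume n: "s K \<le> n"
      have "\<exists>j. n < s j"
      proof -
        obtain j where "real n < \<rho> ^ j" using real_arch_pow[OF \<rho>] by blast
        then have "n < s j" using s_ge[of j] by linarith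
        then show ?thesis ..
      qed
      then obtain j where j: "n < s j" "\<And>i. i < j \<Longrightarrow> \<not> n < s i"
        using exists_least_iff[of "\<lambda>j. n < s j"] by blast
      have "K < j" using j(1) n s_mono[of j K] by linarith
      then obtain k where k: "j = Suc k" "K \<le> k" by (cases j) auto
      have sk: "s k \<le> n" "n < s (Suc k)" using j k by (auto simp: not_less)
      note Kk = K[OF k(2)]
      have G: "G 0 n \<omega> < a * n + y k" using Kk sk unfolding F_def by force
      have \<rho>n: "\<rho> ^ k \<le> n" using s_ge[of k] sk(1) by linarith
      have "0 < \<rho> ^ k" using \<rho> by simp
      then have "ln (\<rho> ^ k) \<le> ln n" using \<rho>n by (subst ln_le_cancel_iff) auto
      then have "k * l \<le> ln n" using \<rho> by (simp add: ln_realpow l_def)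
      then have "0 \<le> ln (k * l)" "ln (k * l) \<le> ln (ln n)" using Kk by auto
      then have "c * ln (k * l) powr (2/3) * b * (\<rho> ^ k) powr (1/3) \<le> c * ln (ln n) powr (2/3) * b * n powr (1/3)"
        using \<rho>n \<open>0 < \<rho> ^ k\<close> \<kappa> b_pos by (intro mult_mono powr_mono2) auto
      then show "G 0 n \<omega> < a * n + c * ln (ln n) powr (2/3) * b * n powr (1/3)"
        using G Kk by linarith
    qed
  qed
qed

section \<open>The lower bound\<close>

text \<open>The independent events \<open>A k\<close> occur infinitely often, but \<open>G 0 (N k)\<close> must not be too small
  at the same time. Since \<open>B m k\<close> depends on earlier rows than \<open>A k, A (k+1), ...\<close>, the reflection
  principle applies with the indices in reverse order.\<close>
lemma AE_frequently_ge:
  assumes c: "0 < c" "c < (3/4) powr (2/3)"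
  shows "AE \<omega> in M. \<forall>m. \<exists>n\<ge>m. a * n + c * ln (ln n) powr (2/3) * b * n powr (1/3) \<le> G 0 n \<omega>"
proof -
  obtain p N1 where p: "0 < p" "\<And>N. N1 \<le> N \<Longrightarrow> p \<le> \<P>(\<omega> in M. a * N \<le> G 0 N \<omega>)"
    by (rule central_probability) blast
  obtain \<kappa> where \<kappa>: "c < \<kappa>" "\<kappa> < (3/4) powr (2/3)" using dense[OF c(2)] by blast
  have \<kappa>_pos: "0 < \<kappa>" using c \<kappa> by linarith
  define N where "N k = k ^ k" for k :: nat
  define d where "d k = N (Suc k) - N k" for k
  define y where "y k = \<kappa> * ln k powr (2/3) * b * d k powr (1/3)" for k
  define A where "A k = {\<omega> \<in> space M. a * d k + y k \<le> G (N k) (N (Suc k)) \<omega>}" for k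
  define B where "B m k = {\<omega> \<in> space M. a * real (N k - m) \<le> G m (N k) \<omega>}" for m k

  have N_Suc: "Suc k * N k \<le> N (Suc k)" for k
    unfolding N_def by (rule Suc_mult_power_self_le)
  have N_ge: "k \<le> N k" for k unfolding N_def using self_le_power[of k k] by (cases k) auto
  have N_step: "N k \<le> N (Suc k)" for k using N_Suc[of k] by simp
  have N_mono: "N j \<le> N k" if "j \<le> k" for j k
    using that by (rule lift_Suc_mono_le[of N, OF N_step])
  have A_window: "A k \<in> window {N k<..N (Suc k)}" for k
    unfolding A_def by (rule G_window[OF N_step])
  have A_events: "A k \<in> events" for k using A_window window_events by blast
  have disj: "disjoint_family (\<lambda>k. {N k<..N (Suc k)})"
  proof -
    have "{N j<..N (Suc j)} \<inter> {N k<..N (Suc k)} = {}" if "j < k" for j k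
      using N_mono[of "Suc j" k] that by auto
    then show ?thesis unfolding disjoint_family_on_def by (metis inf_commute linorder_less_linear)
  qed
  have B_window: "B m k \<in> window {m<..N k}" if "m \<le> k" for m k
    unfolding B_def using that N_ge[of k] by (intro G_window) linarith

  have not_summable: "\<not> summable (\<lambda>k. prob (A k))"
  proof
    assume s: "summable (\<lambda>k. prob (A k))"
    have "\<kappa> powr (3/2) < ((3/4) powr (2/3)) powr (3/2)"
      using \<kappa> \<kappa>_pos by (intro powr_less_mono2) auto
    then have \<theta>: "4/3 * \<kappa> powr (3/2) < 1" by (simp add: powr_powr)
    define \<epsilon> where "\<epsilon> = 1 - 4/3 * \<kappa> powr (3/2)"
    have \<epsilon>: "0 < \<epsilon>" "- (4/3 * \<kappa> powr (3/2) + \<epsilon>) = -1" using \<theta> by (auto simp: \<epsilon>_def)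
    have d_ge: "k \<le> d k" if "1 \<le> k" for k
    proof -
      have "N k * k \<le> d k" using N_Suc[of k] by (simp add: d_def algebra_simps)
      moreover have "1 * k \<le> N k * k" using N_ge[of k] that by (intro mult_right_mono) auto
      ultimately show ?thesis by linarith
    qed
    then have "eventually (\<lambda>k. k \<le> d k) sequentially"
      by (intro eventually_sequentiallyI[of 1])
    from tail_estimate[OF \<kappa>_pos \<epsilon>(1) this]
    have "eventually (\<lambda>k. norm (real k powr -1) \<le> prob (A k)) sequentially"
      using eventually_ge_at_top[of 1]
    proof eventually_elim
      case (elim k)
      have "prob (A k) = \<P>(\<omega> in M. a * d k + y k \<le> G 0 (d k) \<omega>)"
        unfolding A_def d_def using d_ge[OF elim(2)] elim(2) by (intro stationary) (simp add: d_def)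
      then show ?case using elim unfolding \<epsilon>(2) y_def by simp
    qed
    from summable_comparison_test_ev[OF this s]
    have "summable (\<lambda>k. real k powr -1)" .
    then show False by (subst (asm) summable_real_powr_iff) simp
  qed

  have "eventually (\<lambda>k. c * ln (ln (N (Suc k))) powr (2/3) * b * N (Suc k) powr (1/3) \<le> y k - \<bar>a\<bar> * k) sequentially"
    unfolding N_def d_def y_def by (rule eventually_threshold_le) (use b_pos c \<kappa> in auto)
  then obtain K0 where K0: "\<And>k. K0 \<le> k \<Longrightarrow> c * ln (ln (N (Suc k))) powr (2/3) * b * N (Suc k) powr (1/3)
      \<le> y k - \<bar>a\<bar> * k"
    unfolding eventually_sequentially by blast
  define K where "K = Suc (max K0 N1)"
  define U where "U m = (\<Union>k\<in>{m + K..}. A k \<inter> B m k)" for m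
  have U_window: "U m \<in> window {m<..}" for m
  proof -
    interpret sigma_algebra "space M" "window {m<..}" by (rule sigma_algebra_window)
    have "A k \<inter> B m k \<in> window {m<..}" if "m + K \<le> k" for k
    proof -
      have "m \<le> N k" using that N_ge[of k] by linarith
      then have "A k \<in> window {m<..}" by (intro in_window_mono[OF A_window]) auto
      moreover have "B m k \<in> window {m<..}"
        using that by (intro in_window_mono[OF B_window]) auto
      ultimately show ?thesis by (rule Int)
    qed
    then show ?thesis unfolding U_def by (intro countable_UN'') auto
  qed
  (* The index i stands for k = m + K + (l - Suc i), so that the first i with A k is the last k. *)
  have U_prob: "p \<le> prob (U m)" for m
  proof (rule second_Borel_Cantelli_bound[OF windows_indep[OF disj] sigma_algebra_window A_window
        not_summable p(1), of "m + K"])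
    fix l
    let ?A = "\<lambda>i. A (m + K + (l - Suc i))" and ?B = "\<lambda>i. B m (m + K + (l - Suc i))"
    have rev: "(\<Union>i<l. f (l - Suc i)) = (\<Union>i<l. f i)" for f :: "nat \<Rightarrow> 'w set"
    proof (intro equalityI UN_least)
      fix i assume i: "i \<in> {..<l}"
      then show "f (l - Suc i) \<subseteq> (\<Union>i<l. f i)" by (intro UN_upper) auto
      have "f (l - Suc (l - Suc i)) \<subseteq> (\<Union>i<l. f (l - Suc i))"
        using i by (intro UN_upper[of _ _ "\<lambda>i. f (l - Suc i)"]) auto
      then show "f i \<subseteq> (\<Union>i<l. f (l - Suc i))" using i by (simp add: Suc_diff_Suc)
    qed
    have "p * prob (\<Union>i<l. ?A i) \<le> prob (\<Union>i<l. ?A i \<inter> ?B i)"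
    proof (rule prob_UN_Int_ge)
      fix i assume i: "i < l"
      let ?k = "m + K + (l - Suc i)"
      show "?A i \<in> events" by (rule A_events)
      have B: "?B i \<in> window {m<..N ?k}" by (rule B_window) simp
      then show "?B i \<in> events" using window_events by blast
      have D: "disjointed ?A i \<in> window {N ?k<..}"
      proof -
        interpret sigma_algebra "space M" "window {N ?k<..}" by (rule sigma_algebra_window)
        have "?A j \<in> window {N ?k<..}" if "j \<le> i" for j
        proof -
          have "N ?k \<le> N (m + K + (l - Suc j))" using that by (intro N_mono) simp
          then show ?thesis by (intro in_window_mono[OF A_window]) auto
        qed
        then show ?thesis unfolding disjointed_def by (intro Diff finite_UN) auto
      qed
      show "prob (disjointed ?A i \<inter> ?B i) = prob (disjointed ?A i) * prob (?B i)"
        by (rule prob_Int_window[OF _ D B]) auto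
      have k: "m + N1 < N ?k" using N_ge[of ?k] by (simp add: K_def)
      then have "prob (?B i) = \<P>(\<omega> in M. a * real (N ?k - m) \<le> G 0 (N ?k - m) \<omega>)"
        unfolding B_def by (intro stationary) auto
      then show "p \<le> prob (?B i)" using p(2)[of "N ?k - m"] k by simp
    qed
    also have "(\<Union>i<l. ?A i) = (\<Union>i<l. A (m + K + i))" using rev[of "\<lambda>i. A (m + K + i)"] .
    also have "prob (\<Union>i<l. ?A i \<inter> ?B i) \<le> prob (U m)"
    proof (rule finite_measure_mono)
      show "(\<Union>i<l. ?A i \<inter> ?B i) \<subseteq> U m"
        unfolding U_def
      proof (rule UN_least)
        fix i
        show "?A i \<inter> ?B i \<subseteq> (\<Union>k\<in>{m + K..}. A k \<inter> B m k)"
          by (rule UN_upper[of "m + K + (l - Suc i)" "{m + K..}" "\<lambda>k. A k \<inter> B m k"]) simp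
      qed
      show "U m \<in> events" using U_window window_events by blast
    qed
    finally show "p * prob (\<Union>i<l. A (m + K + i)) \<le> prob (U m)" .
  qed

  (* U m does not depend on the first m rows, so its superior limit is a tail event. *)
  define V where "V n = (\<Union>m\<in>{n..}. U m)" for n
  have V_window: "V n \<in> window {n..}" for n
  proof -
    interpret sigma_algebra "space M" "window {n..}" by (rule sigma_algebra_window)
    have "U m \<in> window {n..}" if "n \<le> m" for m
      using that by (intro in_window_mono[OF U_window]) auto
    then show ?thesis unfolding V_def by (intro countable_UN'') auto
  qed
  have V_anti: "V n \<subseteq> V m" if "m \<le> n" for m n unfolding V_def by (rule UN_mono) (use that in auto)
  have "(\<Inter>n. V n) \<in> tail_events E"
    unfolding tail_events_def
  proof
    fix m
    interpret sigma_algebra "space M" "window {m..}" by (rule sigma_algebra_window)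
    have "V n \<in> window {m..}" if "m \<le> n" for n
      using that by (intro in_window_mono[OF V_window]) auto
    then have "(\<Inter>n\<in>{m..}. V n) \<in> window {m..}" by (intro countable_INT) auto
    moreover have "(\<Inter>n\<in>{m..}. V n) = (\<Inter>n. V n)"
    proof (intro equalityI INT_greatest)
      fix n
      have "(\<Inter>n\<in>{m..}. V n) \<subseteq> V (max m n)" by (rule INT_lower) simp
      also have "\<dots> \<subseteq> V n" by (rule V_anti) simp
      finally show "(\<Inter>n\<in>{m..}. V n) \<subseteq> V n" .
    qed (rule INT_lower, simp)
    ultimately show "(\<Inter>n. V n) \<in> sigma_sets (space M) (\<Union> (E ` {m..}))" by (simp add: window_def)
  qed
  from kolmogorov_0_1_law[OF row_sigma_algebra rows_indep this]
  have "prob (\<Inter>n. V n) = 0 \<or> prob (\<Inter>n. V n) = 1" .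
  moreover have V_events: "V n \<in> events" for n using V_window window_events by blast
  have "p \<le> prob (\<Inter>n. V n)"
  proof (rule LIMSEQ_le_const)
    show "(\<lambda>n. prob (V n)) \<longlonglongrightarrow> prob (\<Inter>n. V n)"
      using V_events V_anti by (intro finite_Lim_measure_decseq) (auto simp: decseq_def)
    have "prob (U n) \<le> prob (V n)" for n
      using UN_upper[of n "{n..}" U] V_events by (intro finite_measure_mono) (simp_all add: V_def)
    then show "\<exists>n0. \<forall>n\<ge>n0. p \<le> prob (V n)" using U_prob order_trans by blast
  qed
  ultimately have "prob (\<Inter>n. V n) = 1" using p(1) by linarith
  then have "AE \<omega> in M. \<omega> \<in> (\<Inter>n. V n)" using V_events by (intro AE_prob_1)
  then show ?thesis
    using superadditive G_nonneg
  proof eventually_elim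
    case (elim \<omega>)
    show ?case
    proof
      fix n
      obtain m k where mk: "n \<le> m" "m + K \<le> k" "\<omega> \<in> A k" "\<omega> \<in> B m k"
      proof -
        have "\<omega> \<in> V n" using elim(1) by blast
        then obtain m where "n \<le> m" "\<omega> \<in> U m" unfolding V_def by blast
        then show ?thesis using that unfolding U_def by blast
      qed
      have m: "m \<le> N k" using mk N_ge[of k] by linarith
      have "a * real (N k - m) \<le> G m (N k) \<omega>" "a * d k + y k \<le> G (N k) (N (Suc k)) \<omega>"
        using mk by (auto simp: A_def B_def)
      moreover have "G 0 m \<omega> + G m (N k) \<omega> \<le> G 0 (N k) \<omega>"
        "G 0 (N k) \<omega> + G (N k) (N (Suc k)) \<omega> \<le> G 0 (N (Suc k)) \<omega>"
        using elim(2) m N_step by blast+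
      moreover have "0 \<le> G 0 m \<omega>" using elim(3) by blast
      moreover have "a * real (N k - m) + a * d k = a * N (Suc k) - a * m"
        using m N_step[of k] by (simp add: d_def of_nat_diff algebra_simps)
      moreover have "a * m \<le> \<bar>a\<bar> * k" using mk by (intro mult_mono) auto
      moreover have "c * ln (ln (N (Suc k))) powr (2/3) * b * N (Suc k) powr (1/3) \<le> y k - \<bar>a\<bar> * k"
        using mk by (intro K0) (simp add: K_def)
      ultimately have "a * N (Suc k) + c * ln (ln (N (Suc k))) powr (2/3) * b * N (Suc k) powr (1/3)
          \<le> G 0 (N (Suc k)) \<omega>" by linarith
      moreover have "n \<le> N (Suc k)" using mk N_ge[of k] N_step[of k] by linarith
      ultimately show "\<exists>j\<ge>n. a * j + c * ln (ln j) powr (2/3) * b * j powr (1/3) \<le> G 0 j \<omega>" by blast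
    qed
  qed
qed

section \<open>The law of the iterated logarithm in abstract form\<close>

text \<open>The two bounds hold for each constant outside an exceptional null set that may depend on the
  constant, so they are used along sequences that tend to \<open>(3/4) powr (2/3)\<close> from above and below.\<close>
lemma law_of_iterated_logarithm:
  "AE \<omega> in M. limsup (\<lambda>n. ereal ((G 0 n \<omega> - a * n) / (b * n powr (1/3)) / ln (ln n) powr (2/3)))
      = ereal ((3/4) powr (2/3))"
proof -
  define c0 :: real where "c0 = (3/4) powr (2/3)"
  have c0: "0 < c0" by (simp add: c0_def)
  define cu where "cu j = c0 * (1 + 1 / real (Suc j))" for j
  define cl where "cl j = c0 * (1 - 1 / real (j + 2))" for j
  have cu: "c0 < cu j" for j using c0 by (simp add: cu_def)
  have cl: "0 < cl j" "cl j < c0" for j using c0 by (simp_all add: cl_def)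
  have cu_lim: "cu \<longlonglongrightarrow> c0" unfolding cu_def by real_asymp
  have cl_lim: "cl \<longlonglongrightarrow> c0" unfolding cl_def by real_asymp
  have pos: "0 < b * n powr (1/3)" "0 < ln (ln n) powr (2/3)" if "3 \<le> n" for n :: nat
  proof -
    have "exp 1 < real n" using that e_less_272 by simp
    then have "1 < ln n" using that by (subst exp_less_cancel_iff[symmetric]) simp
    then have "0 < ln (ln n)" by simp
    then show "0 < ln (ln n) powr (2/3)" by simp
    show "0 < b * n powr (1/3)" using that b_pos by simp
  qed
  have "AE \<omega> in M. \<forall>j. eventually (\<lambda>n. G 0 n \<omega> < a * n + cu j * ln (ln n) powr (2/3) * b * n powr (1/3)) sequentially"
    unfolding AE_all_countable using cu by (auto intro!: AE_eventually_less simp flip: c0_def)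
  moreover have "AE \<omega> in M. \<forall>j. \<forall>m. \<exists>n\<ge>m. a * n + cl j * ln (ln n) powr (2/3) * b * n powr (1/3) \<le> G 0 n \<omega>"
    by (subst AE_all_countable, intro allI AE_frequently_ge) (use cl in \<open>simp_all flip: c0_def\<close>)
  ultimately show ?thesis
  proof eventually_elim
    case (elim \<omega>)
    let ?f = "\<lambda>n::nat. (G 0 n \<omega> - a * n) / (b * n powr (1/3)) / ln (ln n) powr (2/3)"
    have "limsup (\<lambda>n. ereal (?f n)) \<le> ereal (cu j)" for j
    proof (rule Limsup_bounded)
      show "eventually (\<lambda>n. ereal (?f n) \<le> ereal (cu j)) sequentially"
        using elim(1)[rule_format, of j] eventually_ge_at_top[of 3]
      proof eventually_elim
        case (elim n)
        then have "G 0 n \<omega> - a * n \<le> cu j * (b * n powr (1/3) * ln (ln n) powr (2/3))"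
          by (simp add: mult_ac)
        then show ?case using pos[OF elim(2)] by (simp add: pos_divide_le_eq)
      qed
    qed
    then have "limsup (\<lambda>n. ereal (?f n)) \<le> ereal c0"
      by (intro LIMSEQ_le_const[OF tendsto_ereal[OF cu_lim]]) auto
    moreover have "ereal (cl j) \<le> limsup (\<lambda>n. ereal (?f n))" for j
    proof (rule limsup_ge_if_frequently)
      fix m
      obtain n where n: "max m 3 \<le> n" "a * n + cl j * ln (ln n) powr (2/3) * b * n powr (1/3) \<le> G 0 n \<omega>"
        using elim(2) by blast
      then have "cl j * (b * n powr (1/3) * ln (ln n) powr (2/3)) \<le> G 0 n \<omega> - a * n"
        by (simp add: mult_ac)
      then have "cl j \<le> ?f n" using pos[of n] n(1) by (simp add: pos_le_divide_eq)
      then show "\<exists>n\<ge>m. ereal (cl j) \<le> ereal (?f n)" using n(1) by auto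
    qed
    then have "ereal c0 \<le> limsup (\<lambda>n. ereal (?f n))"
      by (intro LIMSEQ_le_const2[OF tendsto_ereal[OF cl_lim]]) auto
    ultimately show ?case unfolding c0_def by (rule antisym)
  qed
qed

end

section \<open>Laws of the passage times\<close>

lemma (in prob_space) indep_vars_reindex:
  assumes "indep_vars (\<lambda>_. N) X (f ` I)" "inj_on f I"
  shows "indep_vars (\<lambda>_. N) (\<lambda>i. X (f i)) I"
  unfolding indep_vars_def2
proof (intro conjI ballI)
  let ?E = "\<lambda>i. {X i -` A \<inter> space M |A. A \<in> sets N}"
  show "random_variable N (X (f i))" if "i \<in> I" for i
    using assms(1) that unfolding indep_vars_def2 by blast
  have E: "indep_sets ?E (f ` I)" using assms(1) unfolding indep_vars_def2 by blast
  show "indep_sets (\<lambda>i. ?E (f i)) I"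
  proof (rule indep_setsI)
    show "?E (f i) \<subseteq> events" if "i \<in> I" for i using E that unfolding indep_sets_def by blast
    fix A J assume J: "J \<noteq> {}" "J \<subseteq> I" "finite J" "\<forall>j\<in>J. A j \<in> ?E (f j)"
    have inj: "inj_on f J" using assms(2) J(2) by (rule inj_on_subset)
    let ?B = "\<lambda>k. A (the_inv_into J f k)"
    have B: "?B (f j) = A j" if "j \<in> J" for j using that inj by (simp add: the_inv_into_f_f)
    have "prob (\<Inter>k\<in>f ` J. ?B k) = (\<Prod>k\<in>f ` J. prob (?B k))"
    proof (rule indep_setsD[OF E])
      show "\<forall>k\<in>f ` J. ?B k \<in> ?E k" using B J(4) by auto
    qed (use J in auto)
    then show "prob (\<Inter>j\<in>J. A j) = (\<Prod>j\<in>J. prob (A j))"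
      using B by (simp add: prod.reindex[OF inj])
  qed
qed

text \<open>By independence the joint law of the weights in the rectangle is the product of their
  marginal laws, and the passage time is a function of these weights.\<close>
lemma (in prob_space) last_passage_identically_distributed:
  assumes X: "indep_vars (\<lambda>_. borel) X ({1..m} \<times> {1..n})"
    and Y: "indep_vars (\<lambda>_. borel) Y ({1..m} \<times> {1..n})"
    and eq: "\<And>p. p \<in> {1..m} \<times> {1..n} \<Longrightarrow> distr M borel (X p) = distr M borel (Y p)"
    and "1 \<le> m" "1 \<le> n"
  shows "\<P>(\<omega> in M. y \<le> last_passage X m n \<omega>) = \<P>(\<omega> in M. y \<le> last_passage Y m n \<omega>)"
proof -
  let ?I = "{1..m} \<times> {1..n}"
  let ?PM = "\<Pi>\<^sub>M p\<in>?I. (borel :: real measure)"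
  let ?F = "last_passage (\<lambda>p x. x p) m n :: (nat \<times> nat \<Rightarrow> real) \<Rightarrow> real"
  have ne: "?I \<noteq> {}" using assms(4,5) by auto
  have [measurable]: "?F \<in> borel_measurable ?PM"
    by (rule last_passage_measurable) measurable
  have law: "\<P>(\<omega> in M. y \<le> last_passage Z m n \<omega>)
      = measure (\<Pi>\<^sub>M p\<in>?I. distr M borel (Z p)) {x \<in> space ?PM. y \<le> ?F x}"
    if Z: "indep_vars (\<lambda>_. borel) Z ?I" for Z
  proof -
    have rv: "random_variable borel (Z p)" if "p \<in> ?I" for p
      using Z that unfolding indep_vars_def2 by blast
    have rvI: "random_variable ?PM (\<lambda>\<omega>. \<lambda>p\<in>?I. Z p \<omega>)" by (intro measurable_restrict rv)
    have S: "{x \<in> space ?PM. y \<le> ?F x} \<in> sets ?PM" by measurable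
    have "(\<Pi>\<^sub>M p\<in>?I. distr M borel (Z p)) = distr M ?PM (\<lambda>\<omega>. \<lambda>p\<in>?I. Z p \<omega>)"
      using indep_vars_iff_distr_eq_PiM'[OF ne, where M' = "\<lambda>_. borel" and X = Z, OF rv] Z by simp
    then have "measure (\<Pi>\<^sub>M p\<in>?I. distr M borel (Z p)) {x \<in> space ?PM. y \<le> ?F x}
        = prob ((\<lambda>\<omega>. \<lambda>p\<in>?I. Z p \<omega>) -` {x \<in> space ?PM. y \<le> ?F x} \<inter> space M)"
      using measure_distr[OF rvI S] by (simp only:)
    also have "(\<lambda>\<omega>. \<lambda>p\<in>?I. Z p \<omega>) -` {x \<in> space ?PM. y \<le> ?F x} \<inter> space M
        = {\<omega> \<in> space M. y \<le> last_passage Z m n \<omega>}"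
    proof -
      have "?F (\<lambda>p\<in>?I. Z p \<omega>) = last_passage Z m n \<omega>" for \<omega>
        by (rule last_passage_cong) simp
      then show ?thesis using measurable_space[OF rvI] by auto
    qed
    finally show ?thesis by simp
  qed
  have "(\<Pi>\<^sub>M p\<in>?I. distr M borel (X p)) = (\<Pi>\<^sub>M p\<in>?I. distr M borel (Y p))"
    using eq by (intro PiM_cong) auto
  then show ?thesis using law[OF X] law[OF Y] by simp
qed

text \<open>The given point masses add up to 1, so the law has no mass elsewhere and is determined by
  them.\<close>
lemma (in prob_space) geometric_sums_prob:
  assumes rv: "random_variable borel X" and q: "0 < q" "q < 1"
    and X: "\<And>k::nat. \<P>(\<omega> in M. X \<omega> = real k) = (1 - q) * q ^ k"
  shows "AE \<omega> in M. \<exists>k::nat. X \<omega> = real k"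
    and "A \<in> sets borel \<Longrightarrow> (\<lambda>k::nat. if real k \<in> A then (1 - q) * q ^ k else 0) sums prob (X -` A \<inter> space M)"
proof -
  let ?B = "\<lambda>A k. {\<omega> \<in> space M. X \<omega> = real k \<and> real k \<in> A}"
  have B: "?B A k \<in> events" for A k using rv by measurable
  have sums: "(\<lambda>k. if real k \<in> A then (1 - q) * q ^ k else 0) sums prob (\<Union>k. ?B A k)" for A
  proof -
    have "(\<lambda>k. prob (?B A k)) sums prob (\<Union>k. ?B A k)"
      using B by (intro finite_measure_UNION) (auto simp: disjoint_family_on_def)
    moreover have "prob (?B A k) = (if real k \<in> A then (1 - q) * q ^ k else 0)" for k
      using X[of k] by simp
    ultimately show ?thesis by simp
  qed
  have "(\<lambda>k. (1 - q) * q ^ k) sums ((1 - q) * (1 / (1 - q)))"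
    using q by (intro sums_mult geometric_sums) auto
  then have "prob (\<Union>k. ?B UNIV k) = 1"
    using sums[of UNIV] q by (simp add: sums_iff)
  then have "AE \<omega> in M. \<omega> \<in> (\<Union>k. ?B UNIV k)" by (rule AE_prob_1)
  then show AE: "AE \<omega> in M. \<exists>k::nat. X \<omega> = real k" by eventually_elim auto
  assume A: "A \<in> sets borel"
  have "prob (X -` A \<inter> space M) = prob (\<Union>k. ?B A k)"
  proof (rule finite_measure_eq_AE)
    show "AE \<omega> in M. (\<omega> \<in> X -` A \<inter> space M) = (\<omega> \<in> (\<Union>k. ?B A k))"
      using AE by eventually_elim auto
    show "X -` A \<inter> space M \<in> events" using rv A by measurable
    show "(\<Union>k. ?B A k) \<in> events" using B by (intro sets.countable_UN) auto
  qed
  with sums[of A] show "(\<lambda>k::nat. if real k \<in> A then (1 - q) * q ^ k else 0) sums prob (X -` A \<inter> space M)"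
    by simp
qed

lemma (in prob_space) exponential_case_law:
  assumes "exponential_case M X \<gamma> a b"
  shows "p \<in> lattice \<Longrightarrow> p' \<in> lattice \<Longrightarrow> distr M borel (X p) = distr M borel (X p')"
    and "p \<in> lattice \<Longrightarrow> AE \<omega> in M. 0 \<le> X p \<omega>"
proof -
  have D: "distributed M lborel (X p) (exponential_density 1)" if "p \<in> lattice" for p
    using assms that unfolding exponential_case_def by blast
  have law: "distr M borel (X p) = density lborel (exponential_density 1)" if "p \<in> lattice" for p
    using distributed_distr_eq_density[OF D[OF that]]
    by (simp cong: distr_cong)
  show "distr M borel (X p) = distr M borel (X p')" if "p \<in> lattice" "p' \<in> lattice"
    using that by (simp add: law)
  show "AE \<omega> in M. 0 \<le> X p \<omega>" if p: "p \<in> lattice"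
  proof -
    have "AE x in distr M borel (X p). 0 \<le> x"
      unfolding law[OF p] by (subst AE_density) (auto simp: exponential_density_def)
    moreover have "random_variable borel (X p)"
      using distributed_measurable[OF D[OF p]] by simp
    ultimately show ?thesis using AE_distrD by blast
  qed
qed

lemma (in prob_space) geometric_case_law:
  assumes "geometric_case M X \<gamma> a b" and rv: "\<And>p. p \<in> lattice \<Longrightarrow> random_variable borel (X p)"
  shows "p \<in> lattice \<Longrightarrow> p' \<in> lattice \<Longrightarrow> distr M borel (X p) = distr M borel (X p')"
    and "p \<in> lattice \<Longrightarrow> AE \<omega> in M. 0 \<le> X p \<omega>"
proof -
  obtain q where q: "0 < q" "q < 1"
    and X: "\<And>p k. p \<in> lattice \<Longrightarrow> \<P>(\<omega> in M. X p \<omega> = real k) = (1 - q) * q ^ k"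
    using assms(1) unfolding geometric_case_def by blast
  note geo = geometric_sums_prob[OF rv q X]
  show "distr M borel (X p) = distr M borel (X p')" if p: "p \<in> lattice" "p' \<in> lattice"
  proof (rule measure_eqI)
    fix A assume "A \<in> sets (distr M borel (X p))"
    then have A: "A \<in> sets borel" by simp
    have "prob (X p -` A \<inter> space M) = prob (X p' -` A \<inter> space M)"
      using geo(2)[OF p(1) p(1) A] geo(2)[OF p(2) p(2) A] by (rule sums_unique2)
    then show "emeasure (distr M borel (X p)) A = emeasure (distr M borel (X p')) A"
      using A rv p by (simp add: emeasure_distr emeasure_eq_measure)
  qed simp
  show "AE \<omega> in M. 0 \<le> X p \<omega>" if p: "p \<in> lattice"
    using geo(1)[OF p p] by eventually_elim auto
qed

section \<open>Last passage times as a superadditive process\<close>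

definition row_events :: "'w measure \<Rightarrow> (nat \<times> nat \<Rightarrow> 'w \<Rightarrow> real) \<Rightarrow> nat \<Rightarrow> 'w set set" where
  "row_events M X j = sigma_sets (space M)
     (\<Union>p\<in>{p \<in> lattice. snd p = j}. {X p -` A \<inter> space M | A. A \<in> sets borel})"

definition passage_between ::
  "(nat \<times> nat \<Rightarrow> 'w \<Rightarrow> real) \<Rightarrow> real \<Rightarrow> nat \<Rightarrow> nat \<Rightarrow> 'w \<Rightarrow> real" where
  "passage_between X \<gamma> s t \<omega> = (if s < t then
     last_passage (\<lambda>p. X (nat \<lfloor>\<gamma> * real s\<rfloor> + fst p, s + snd p)) (nat \<lfloor>\<gamma> * real (t - s)\<rfloor>) (t - s) \<omega>
     else 0)"

lemma passage_between_zero: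
  "1 \<le> N \<Longrightarrow> passage_between X \<gamma> 0 N \<omega> = last_passage X (nat \<lfloor>\<gamma> * real N\<rfloor>) N \<omega>"
  by (simp add: passage_between_def)

lemma floor_width_ge:
  fixes \<gamma> :: real
  assumes "1 \<le> \<gamma>" "1 \<le> n"
  shows "1 \<le> nat \<lfloor>\<gamma> * real n\<rfloor>"
proof -
  have "1 * 1 \<le> \<gamma> * real n" using assms by (intro mult_mono) auto
  then show ?thesis by linarith
qed

text \<open>The two widths \<open>\<lfloor>\<gamma> * s\<rfloor>\<close> and \<open>\<lfloor>\<gamma> * (t - s)\<rfloor>\<close> may add up to one less than
  \<open>\<lfloor>\<gamma> * t\<rfloor>\<close>; monotonicity in the width covers the difference.\<close>
lemma passage_between_superadditive:
  assumes "1 \<le> \<gamma>" and nonneg: "\<And>p. p \<in> lattice \<Longrightarrow> 0 \<le> X p \<omega>" and "s \<le> t"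
  shows "passage_between X \<gamma> 0 s \<omega> + passage_between X \<gamma> s t \<omega> \<le> passage_between X \<gamma> 0 t \<omega>"
proof (cases "0 < s \<and> s < t")
  case True
  let ?m = "nat \<lfloor>\<gamma> * real s\<rfloor>" and ?m' = "nat \<lfloor>\<gamma> * real (t - s)\<rfloor>" and ?w = "nat \<lfloor>\<gamma> * real t\<rfloor>"
  have m: "1 \<le> ?m" "1 \<le> ?m'" using True by (intro floor_width_ge[OF assms(1)]; linarith)+
  have "\<gamma> * real t = \<gamma> * real s + \<gamma> * real (t - s)"
    using True by (simp add: of_nat_diff algebra_simps)
  then have le: "?m + ?m' \<le> ?w" using m le_floor_add[of "\<gamma> * real s" "\<gamma> * real (t - s)"] by linarith
  have "last_passage X ?m s \<omega> + last_passage (\<lambda>p. X (?m + fst p, s + snd p)) ?m' (t - s) \<omega>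
      \<le> last_passage X (?m + ?m') (s + (t - s)) \<omega>"
    using True m by (intro last_passage_superadditive nonneg) auto
  also have "\<dots> \<le> last_passage X ?w (s + (t - s)) \<omega>"
    using True m le by (intro last_passage_mono nonneg) auto
  finally show ?thesis using True by (simp add: passage_between_def)
qed (use assms in \<open>auto simp: passage_between_def\<close>)

text \<open>Grouping the weights by their second coordinate turns independence of the weights into that of
  the rows. The passage time from \<open>s\<close> to \<open>t\<close> uses the weights in a translate of the rectangle that is
  used from \<open>0\<close> to \<open>t - s\<close>, and all of them lie in the rows \<open>s + 1, ..., t\<close>.\<close>
lemma superadditive_passage_last_passage:
  assumes "prob_space M" and indep: "prob_space.indep_vars M (\<lambda>_. borel) X lattice" and \<gamma>: "\<gamma> \<ge> 1"
    and law: "\<And>p p'. p \<in> lattice \<Longrightarrow> p' \<in> lattice \<Longrightarrow> distr M borel (X p) = distr M borel (X p')"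
    and nonneg: "\<And>p. p \<in> lattice \<Longrightarrow> AE \<omega> in M. 0 \<le> X p \<omega>"
    and const: "0 < b" "1 < x0" "0 < \<delta>" "0 < C" "1 \<le> N0"
    and tail: "tail_bound M X \<gamma> a b x0 \<delta> C N0"
  shows "superadditive_passage M (row_events M X) (passage_between X \<gamma>) a b x0 \<delta> C N0"
proof -
  interpret prob_space M by fact
  let ?E = "\<lambda>p. {X p -` A \<inter> space M | A. A \<in> sets borel}"
  let ?G = "passage_between X \<gamma>"
  have rv: "random_variable borel (X p)" if "p \<in> lattice" for p
    using indep that unfolding indep_vars_def2 by blast
  have "indep_sets ?E (\<Union>j. {p \<in> lattice. snd p = j})"
    using indep unfolding indep_vars_def2 by (simp add: UN_extend_simps Collect_ex_eq[symmetric])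
  then have rows: "indep_sets (row_events M X) UNIV"
    unfolding row_events_def
  proof (rule indep_sets_collect_sigma)
    fix p
    show "Int_stable (?E p)"
    proof (rule Int_stableI)
      fix S T assume "S \<in> ?E p" "T \<in> ?E p"
      then obtain A B where "S = X p -` A \<inter> space M" "T = X p -` B \<inter> space M"
        "A \<in> sets borel" "B \<in> sets borel" by blast
      then show "S \<inter> T \<in> ?E p" by (intro CollectI exI[of _ "A \<inter> B"]) auto
    qed
  qed (auto simp: disjoint_family_on_def)
  interpret independent_rows M "row_events M X"
  proof (intro independent_rows.intro independent_rows_axioms.intro prob_space_axioms)
    show "sigma_algebra (space M) (row_events M X j)" for j
      unfolding row_events_def by (rule sigma_algebra_sigma_sets) auto
  qed (rule rows)

  show ?thesis
  proof unfold_locales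
    fix s t :: nat and y :: real
    assume st: "s \<le> t"
    show "{\<omega> \<in> space M. y \<le> ?G s t \<omega>} \<in> window {s<..t}"
    proof (cases "s < t")
      case True
      let ?N = "sigma (space M) (\<Union>j\<in>{s<..t}. row_events M X j)"
      have N: "space ?N = space M" "sets ?N = window {s<..t}"
        using row_subset_Pow by (simp_all add: space_measure_of sets_measure_of window_def)
      have X_N: "X p \<in> borel_measurable ?N" if p: "p \<in> lattice" "s < snd p" "snd p \<le> t" for p
      proof (rule measurableI)
        fix A :: "real set" assume "A \<in> sets borel"
        then have "X p -` A \<inter> space M \<in> row_events M X (snd p)"
          unfolding row_events_def using p(1) by (intro sigma_sets.Basic) blast
        then show "X p -` A \<inter> space ?N \<in> sets ?N"
          unfolding N window_def using p by (intro sigma_sets.Basic) auto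
      qed simp
      have "?G s t \<in> borel_measurable ?N"
        unfolding passage_between_def[abs_def] using True
        by (auto intro!: last_passage_measurable X_N simp: lattice_def)
      then have "{\<omega> \<in> space ?N. y \<le> ?G s t \<omega>} \<in> sets ?N" by measurable
      then show ?thesis unfolding N .
    next
      case False
      then show ?thesis
        by (cases "y \<le> 0")
          (auto simp: passage_between_def window_def intro: sigma_sets_top sigma_sets.Empty)
    qed
  next
    have "AE \<omega> in M. \<forall>p\<in>lattice. 0 \<le> X p \<omega>"
      using nonneg by (subst AE_ball_countable) auto
    then have "AE \<omega> in M. (\<forall>s. 0 \<le> ?G 0 s \<omega>) \<and> (\<forall>s t. s \<le> t \<longrightarrow> ?G 0 s \<omega> + ?G s t \<omega> \<le> ?G 0 t \<omega>)"
    proof eventually_elim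
      case (elim \<omega>)
      have nonneg: "0 \<le> X p \<omega>" if "p \<in> lattice" for p using elim that by (rule bspec)
      have "0 \<le> ?G 0 s \<omega>" for s
      proof (cases "s = 0")
        case False
        then have "1 \<le> s" by simp
        with floor_width_ge[OF \<gamma> this] show ?thesis
          unfolding passage_between_zero[OF \<open>1 \<le> s\<close>] by (intro last_passage_nonneg nonneg)
      qed (simp add: passage_between_def)
      moreover have "?G 0 s \<omega> + ?G s t \<omega> \<le> ?G 0 t \<omega>" if "s \<le> t" for s t
        using nonneg that by (rule passage_between_superadditive[OF \<gamma>])
      ultimately show ?case by blast
    qed
    then show "AE \<omega> in M. \<forall>s. 0 \<le> ?G 0 s \<omega>"
      "AE \<omega> in M. \<forall>s t. s \<le> t \<longrightarrow> ?G 0 s \<omega> + ?G s t \<omega> \<le> ?G 0 t \<omega>"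
      by (auto elim: eventually_mono)
  next
    fix s t :: nat and y :: real
    assume st: "s < t"
    let ?m = "nat \<lfloor>\<gamma> * real (t - s)\<rfloor>"
    let ?s = "\<lambda>p. (nat \<lfloor>\<gamma> * real s\<rfloor> + fst p, s + snd p)"
    let ?I = "{1..?m} \<times> {1..t - s}"
    have sub: "?I \<subseteq> lattice" "?s ` ?I \<subseteq> lattice" by (auto simp: lattice_def)
    have "\<P>(\<omega> in M. y \<le> last_passage (\<lambda>p. X (?s p)) ?m (t - s) \<omega>)
        = \<P>(\<omega> in M. y \<le> last_passage X ?m (t - s) \<omega>)"
    proof (rule last_passage_identically_distributed)
      show "indep_vars (\<lambda>_. borel) X ?I" using indep sub(1) by (rule indep_vars_subset)
      have "inj_on ?s ?I" by (auto simp: inj_on_def prod_eq_iff)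
      with indep_vars_subset[OF indep sub(2)]
      show "indep_vars (\<lambda>_. borel) (\<lambda>p. X (?s p)) ?I" by (rule indep_vars_reindex)
      show "distr M borel (X (?s p)) = distr M borel (X p)" if "p \<in> ?I" for p
        using sub that by (intro law) blast+
      show "1 \<le> ?m" using st by (intro floor_width_ge[OF \<gamma>]) simp
    qed (use st in simp)
    then show "\<P>(\<omega> in M. y \<le> ?G s t \<omega>) = \<P>(\<omega> in M. y \<le> ?G 0 (t - s) \<omega>)"
      using st by (simp add: passage_between_def)
  next
    fix N :: nat and x :: real
    assume "N0 \<le> N" "x0 \<le> x" "x \<le> \<delta> * real N powr (1/3)"
    moreover have "1 \<le> N" using const(5) \<open>N0 \<le> N\<close> by simp
    ultimately show "0 < \<P>(\<omega> in M. a * N + x * b * N powr (1/3) \<le> ?G 0 N \<omega>) \<and>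
      \<bar>ln (\<P>(\<omega> in M. a * N + x * b * N powr (1/3) \<le> ?G 0 N \<omega>)) + 4/3 * x powr (3/2)\<bar>
        \<le> C * (x\<^sup>2 * N powr (-1/3) + ln x)"
      using tail unfolding tail_bound_def Let_def by (simp add: passage_between_zero)
  qed (use const in auto)
qed

theorem mainTheorem3:
  fixes M :: "'w measure" and X :: "nat \<times> nat \<Rightarrow> 'w \<Rightarrow> real" and \<gamma> a b :: real
  assumes "prob_space M"
    and "prob_space.indep_vars M (\<lambda>_. borel) X lattice"
    and "\<gamma> \<ge> 1"
    and "exponential_case M X \<gamma> a b \<or> geometric_case M X \<gamma> a b"
    and "\<exists>x0 \<delta> C N0. x0 > 1 \<and> \<delta> > 0 \<and> C > 0 \<and> N0 \<ge> 1 \<and> tail_bound M X \<gamma> a b x0 \<delta> C N0"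
  shows "AE \<omega> in M.
    limsup (\<lambda>N. ereal (rescaled_passage X \<gamma> a b N \<omega> / ln (ln (real N)) powr (2/3)))
      = ereal ((3/4) powr (2/3))"
proof -
  interpret prob_space M by fact
  have rv: "\<And>p. p \<in> lattice \<Longrightarrow> random_variable borel (X p)"
    using assms(2) unfolding indep_vars_def2 by blast
  have law: "distr M borel (X p) = distr M borel (X p')" if "p \<in> lattice" "p' \<in> lattice" for p p'
    using assms(4) exponential_case_law(1)[where X = X, OF _ that]
      geometric_case_law(1)[where X = X, OF _ rv that] by blast
  have nonneg: "AE \<omega> in M. 0 \<le> X p \<omega>" if "p \<in> lattice" for p
    using assms(4) exponential_case_law(2)[where X = X, OF _ that]
      geometric_case_law(2)[where X = X, OF _ rv that] by blast
  have b: "0 < b"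
    using assms(4)
  proof
    assume "exponential_case M X \<gamma> a b"
    moreover have "0 < 1 + sqrt \<gamma>" using assms(3) by (simp add: add_pos_nonneg)
    ultimately show ?thesis using assms(3) by (simp add: exponential_case_def)
  next
    assume "geometric_case M X \<gamma> a b"
    then obtain q where q: "0 < q" "q < 1" and b: "b = q powr (1/6) * \<gamma> powr (-1/6) / (1 - q)
        * (sqrt \<gamma> + sqrt q) powr (2/3) * (1 + sqrt (q * \<gamma>)) powr (2/3)"
      unfolding geometric_case_def by blast
    have "0 < sqrt \<gamma> + sqrt q" "0 < 1 + sqrt (q * \<gamma>)"
      using q assms(3) by (auto intro!: add_pos_nonneg)
    then show ?thesis unfolding b using q assms(3) by simp
  qed
  obtain x0 \<delta> C N0 where "1 < x0" "0 < \<delta>" "0 < C" "1 \<le> N0" "tail_bound M X \<gamma> a b x0 \<delta> C N0"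
    using assms(5) by blast
  then interpret superadditive_passage M "row_events M X" "passage_between X \<gamma>" a b x0 \<delta> C N0
    by (intro superadditive_passage_last_passage assms(1-3) law nonneg b)
  have "rescaled_passage X \<gamma> a b N \<omega>
      = (passage_between X \<gamma> 0 N \<omega> - a * N) / (b * N powr (1/3))" for N \<omega>
    by (cases "N = 0") (simp_all add: rescaled_passage_def passage_between_zero)
  with law_of_iterated_logarithm show ?thesis by simp
qed

end
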